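(* Let $A$ be a quantum set. Given a reflexive quantum graph $(A,G)$, the map $$P_G:=(m_A\otimes\mathrm{id}_A)(\mathrm{id}_A\otimes G\otimes\mathrm{id}_A)(\mathrm{id}_A\otimes\Delta_A):A\otimes A\to A\otimes A$$ is a symmetric and reflexive quantum relation on $A$. Conversely, given a symmetric and reflexive quantum relation $P$ on $A$, the map $$G:=(\epsilon_A\otimes\mathrm{id}_A)P(\mathrm{id}_A\otimes u_A):A\to A$$ is a quantum adjacency matrix, i.e. $(A,G)$ is a reflexive quantum graph. These two constructions are mutually inverse.
   Context: All Hilbert spaces are finite-dimensional and complex; coherence isomorphisms of $\otimes$ are suppressed. A projector is a self-adjoint idempotent operator. A quantum set is a special symmetric dagger Frobenius algebra: a Hilbert space $A$ with linear maps $m_A:A\otimes A\to A$, $u_A:\mathbb{C}\to A$ forming an associative unital algebra such that, writing $\Delta_A=m_A^\dagger$, $\epsilon_A=u_A^\dagger$, one has $(m_A\otimes \mathrm{id})(\mathrm{id}\otimes\Delta_A)=\Delta_A m_A=(\mathrm{id}\otimes m_A)(\Delta_A\otimes\mathrm{id})$, $m_A\Delta_A=\mathrm{id}_A$, and $\epsilon_A m_A\sigma=\epsilon_A m_A$ with $\sigma$ the swap map. A quantum graph is a pair $(A,G)$ of a quantum set $A$ and a self-adjoint linear map $G:A\to A$ (the quantum adjacency matrix) with $m_A(G\otimes G)\Delta_A=G$ and $(\mathrm{id}_A\otimes\epsilon_Am_A)(\mathrm{id}_A\otimes G\otimes\mathrm{id}_A)(\Delta_Au_A\otimes\mathrm{id}_A)=G$.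 It is reflexive if $m_A(G\otimes\mathrm{id}_A)\Delta_A=\mathrm{id}_A$. A quantum relation on $A$ is a projector $P:A\otimes A\to A\otimes A$ satisfying $P(m_A\otimes m_A)=(m_A\otimes m_A)(\mathrm{id}_A\otimes P\otimes\mathrm{id}_A)$ as maps $A^{\otimes4}\to A\otimes A$. It is symmetric if it equals its own rotation by 180 degrees (formed with the Frobenius cups $\Delta_Au_A$ and caps $\epsilon_Am_A$); equivalently, $\beta_2(Px,w)=\beta_2(x,Pw)$ for all $x,w\in A\otimes A$, where $\beta_2$ is the bilinear form on $A\otimes A$ with $\beta_2(a\otimes b,c\otimes d)=\epsilon_A(m_A(a\otimes d))\,\epsilon_A(m_A(b\otimes c))$. It is reflexive if $P\Delta_Au_A=\Delta_Au_A$. *)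

theory Defs
  imports Complex_Main
begin

section \<open>Finite-dimensional complex Hilbert spaces\<close>

class complex_vector = ab_group_add +
  fixes scaleC :: "complex \<Rightarrow> 'a \<Rightarrow> 'a"  (infixr \<open>*\<^sub>C\<close> 75)
  assumes scaleC_add_right: "a *\<^sub>C (x + y) = a *\<^sub>C x + a *\<^sub>C y"
    and scaleC_add_left: "(a + b) *\<^sub>C x = a *\<^sub>C x + b *\<^sub>C x"
    and scaleC_scaleC: "a *\<^sub>C b *\<^sub>C x = (a * b) *\<^sub>C x"
    and scaleC_one: "1 *\<^sub>C x = x"

global_interpretation cvec: vector_space "scaleC :: complex \<Rightarrow> 'a \<Rightarrow> 'a::complex_vector"
  by unfold_locales (fact scaleC_add_right scaleC_add_left scaleC_scaleC scaleC_one)+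

abbreviation clinear :: "('a::complex_vector \<Rightarrow> 'b::complex_vector) \<Rightarrow> bool"
  where "clinear \<equiv> Vector_Spaces.linear scaleC scaleC"

lemma clinearI:
  assumes "\<And>x y. f (x + y) = f x + f y" and "\<And>c x. f (c *\<^sub>C x) = c *\<^sub>C f x"
  shows "clinear f"
  using assms by unfold_locales auto

lemma clinear_add: "clinear f \<Longrightarrow> f (x + y) = f x + f y"
  by (simp add: linear_iff_module_hom module_hom.add)

lemma clinear_scale: "clinear f \<Longrightarrow> f (c *\<^sub>C x) = c *\<^sub>C f x"
  by (simp add: linear_iff_module_hom module_hom.scale)

lemma clinear_iff:
  "clinear f \<longleftrightarrow> (\<forall>x y. f (x + y) = f x + f y) \<and> (\<forall>c x. f (c *\<^sub>C x) = c *\<^sub>C f x)"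
  by (auto intro: clinearI simp: clinear_add clinear_scale)

lemma clinear_sum: "clinear f \<Longrightarrow> f (\<Sum>i\<in>I. g i) = (\<Sum>i\<in>I. f (g i))"
  by (simp add: linear_iff_module_hom module_hom.sum)

text \<open>The inner product is linear in its second argument. Completeness is automatic in finite
  dimension, and the zero space is allowed.\<close>

class fd_hilbert = complex_vector +
  fixes cinner :: "'a \<Rightarrow> 'a \<Rightarrow> complex"
  assumes cinner_commute: "cinner x y = cnj (cinner y x)"
    and cinner_add_right: "cinner x (y + z) = cinner x y + cinner x z"
    and cinner_scaleC_right: "cinner x (c *\<^sub>C y) = c * cinner x y"
    and cinner_ge_zero: "0 \<le> Re (cinner x x)"
    and cinner_eq_zero_iff: "cinner x x = 0 \<longleftrightarrow> x = 0"
    and finite_dim: "\<exists>B. finite B \<and> (\<forall>x. \<exists>c. x = (\<Sum>b\<in>B. c b *\<^sub>C b))"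

instantiation complex :: fd_hilbert
begin

definition scaleC_complex :: "complex \<Rightarrow> complex \<Rightarrow> complex"
  where [simp]: "scaleC_complex c x = c * x"

definition cinner_complex :: "complex \<Rightarrow> complex \<Rightarrow> complex"
  where [simp]: "cinner_complex x y = cnj x * y"

instance
proof
  show "\<exists>B. finite B \<and> (\<forall>x::complex. \<exists>c. x = (\<Sum>b\<in>B. c b *\<^sub>C b))"
    by (rule exI[of _ "{1}"]) auto
qed (auto simp: algebra_simps)

end

lemma cinner_add_left: "cinner (x + y) z = cinner x z + cinner y z"
  by (metis cinner_commute cinner_add_right complex_cnj_add)

lemma cinner_scaleC_left: "cinner (c *\<^sub>C x) y = cnj c * cinner x y"
  by (metis cinner_commute cinner_scaleC_right complex_cnj_mult)

lemma clinear_cinner_right: "clinear (cinner x)"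
  by (rule clinearI) (auto simp: cinner_add_right cinner_scaleC_right)

lemma cinner_sum_right: "cinner x (\<Sum>i\<in>I. g i) = (\<Sum>i\<in>I. cinner x (g i))"
  by (rule clinear_sum[OF clinear_cinner_right])

lemma cinner_sum_left: "cinner (\<Sum>i\<in>I. g i) x = (\<Sum>i\<in>I. cinner (g i) x)"
proof -
  have "cnj (cinner x (\<Sum>i\<in>I. g i)) = (\<Sum>i\<in>I. cnj (cinner x (g i)))"
    by (simp add: cinner_sum_right)
  then show ?thesis by (simp add: cinner_commute[symmetric])
qed

lemma cinner_zero_right [simp]: "cinner x 0 = 0"
  using cinner_scaleC_right[of x 0 0] by simp

lemma cinner_zero_left [simp]: "cinner 0 x = 0"
  using cinner_commute[of 0 x] by simp

lemma cinner_diff_right: "cinner x (y - z) = cinner x y - cinner x z"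
  by (metis add_diff_cancel cinner_add_right diff_add_cancel)

lemma cinner_ext_right:
  assumes "\<And>z. cinner z x = cinner z y" shows "x = y"
  using assms[of "x - y"] cinner_eq_zero_iff[of "x - y"] by (simp add: cinner_diff_right)

lemma cinner_ext_left:
  assumes "\<And>z. cinner x z = cinner y z" shows "x = y"
  using assms by (metis cinner_commute cinner_ext_right)

definition orthonormal :: "'a::fd_hilbert set \<Rightarrow> bool"
  where "orthonormal B \<longleftrightarrow> (\<forall>x\<in>B. \<forall>y\<in>B. cinner x y = (if x = y then 1 else 0))"

lemma gram_schmidt:
  fixes B :: "'a::fd_hilbert set"
  assumes "finite B"
  shows "\<exists>E. finite E \<and> orthonormal E \<and> cvec.span E = cvec.span B"
  using assms
proof (induction B)
  case empty
  show ?case by (rule exI[of _ "{}"]) (auto simp: orthonormal_def)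
next
  case (insert v B)
  then obtain E where E: "finite E" "orthonormal E" "cvec.span E = cvec.span B" by blast
  define w where "w = v - (\<Sum>e\<in>E. cinner e v *\<^sub>C e)"
  have s: "(\<Sum>e\<in>E. cinner e v *\<^sub>C e) \<in> cvec.span E"
    by (intro cvec.span_sum cvec.span_scale cvec.span_base)
  have span_w: "cvec.span (insert v B) = cvec.span (insert w E)"
  proof -
    have "cvec.span (insert v B) = cvec.span (insert v E)"
      using E(3) by (auto simp: cvec.span_insert)
    also have "\<dots> = cvec.span (insert w E)"
      by (rule cvec.eq_span_insert_eq) (simp add: w_def s)
    finally show ?thesis .
  qed
  have orth: "cinner e w = 0" if e: "e \<in> E" for e
  proof -
    have "(\<Sum>e'\<in>E. cinner e' v * cinner e e') = (\<Sum>e'\<in>E. if e' = e then cinner e v else 0)"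
      using E(2) e by (intro sum.cong) (auto simp: orthonormal_def)
    also have "\<dots> = cinner e v" using E(1) e by simp
    finally show ?thesis
      by (simp add: w_def cinner_diff_right cinner_sum_right cinner_scaleC_right)
  qed
  show ?case
  proof (cases "w = 0")
    case True
    then have "cvec.span (insert w E) = cvec.span E"
      by (simp add: cvec.span_redundant cvec.span_zero)
    then show ?thesis using E span_w by metis
  next
    case False
    define r where "r = Re (cinner w w)"
    have im: "cinner w w = complex_of_real r"
      using cinner_commute[of w w] by (simp add: r_def complex_eq_iff)
    have "r \<noteq> 0" using False cinner_eq_zero_iff[of w] im by auto
    then have r: "r > 0" using cinner_ge_zero[of w] by (simp add: r_def)
    define c where "c = complex_of_real (inverse (sqrt r))"
    define n where "n = c *\<^sub>C w"
    have c: "c \<noteq> 0" "cnj c = c" using r by (auto simp: c_def)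
    have "c * (c * cinner w w) = complex_of_real (inverse (sqrt r) * (inverse (sqrt r) * r))"
      unfolding im c_def by simp
    also have "inverse (sqrt r) * (inverse (sqrt r) * r) = 1"
      using r by (simp add: field_simps)
    finally have n1: "cinner n n = 1"
      by (simp add: n_def cinner_scaleC_right cinner_scaleC_left c)
    have n0: "cinner e n = 0" "cinner n e = 0" if "e \<in> E" for e
      using orth[OF that] cinner_commute[of w e]
      by (auto simp: n_def cinner_scaleC_right cinner_scaleC_left)
    have "orthonormal (insert n E)"
      using E(2) n0 n1 unfolding orthonormal_def by (metis insert_iff zero_neq_one)
    moreover have "cvec.span (insert n E) = cvec.span (insert w E)"
    proof -
      have "n \<in> cvec.span (insert w E)"
        by (simp add: n_def cvec.span_base cvec.span_scale)
      moreover have "w \<in> cvec.span (insert n E)"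
      proof -
        have "w = inverse c *\<^sub>C n" using c by (simp add: n_def)
        then show ?thesis by (metis cvec.span_base cvec.span_scale insertI1)
      qed
      ultimately show ?thesis
        by (intro cvec.span_eq[THEN iffD2]) (auto intro: cvec.span_base)
    qed
    ultimately show ?thesis using E(1) span_w by (intro exI[of _ "insert n E"]) auto
  qed
qed

definition onb :: "'a::fd_hilbert set"
  where "onb = (SOME B. finite B \<and> orthonormal B \<and> cvec.span B = UNIV)"

lemma onb: "finite (onb :: 'a::fd_hilbert set)" "orthonormal (onb :: 'a set)"
  "cvec.span (onb :: 'a set) = UNIV"
proof -
  obtain B :: "'a set" where B: "finite B" "\<forall>x. \<exists>c. x = (\<Sum>b\<in>B. c b *\<^sub>C b)"
    using finite_dim by blast
  have "x \<in> cvec.span B" for x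
  proof -
    obtain c where "x = (\<Sum>b\<in>B. c b *\<^sub>C b)" using B(2) by blast
    then show ?thesis by (auto intro!: cvec.span_sum cvec.span_scale intro: cvec.span_base)
  qed
  with B(1) have "finite B" "cvec.span B = UNIV" by auto
  then have "\<exists>B :: 'a set. finite B \<and> orthonormal B \<and> cvec.span B = UNIV"
    using gram_schmidt by metis
  from someI_ex[OF this] show "finite (onb :: 'a set)" "orthonormal (onb :: 'a set)"
    "cvec.span (onb :: 'a set) = UNIV"
    by (auto simp: onb_def)
qed

lemmas finite_onb [simp, intro] = onb(1)

lemma cinner_onb: "e \<in> onb \<Longrightarrow> e' \<in> onb \<Longrightarrow> cinner e e' = (if e = e' then 1 else 0)"
  using onb(2) by (auto simp: orthonormal_def)

lemma onb_expand: "(\<Sum>e\<in>onb. cinner e x *\<^sub>C e) = x"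
proof -
  have "x \<in> cvec.span onb" by (simp add: onb)
  then show ?thesis
  proof (induction rule: cvec.span_induct_alt)
    case base
    show ?case by simp
  next
    case (step c b y)
    have "(\<Sum>e\<in>onb. (c * cinner e b) *\<^sub>C e) = (\<Sum>e\<in>onb. if e = b then c *\<^sub>C b else 0)"
      using step by (intro sum.cong) (auto simp: cinner_onb)
    also have "\<dots> = c *\<^sub>C b" using step by simp
    finally show ?case using step
      by (simp add: cinner_add_right cinner_scaleC_right scaleC_add_left sum.distrib)
  qed
qed

definition adj :: "('a::fd_hilbert \<Rightarrow> 'b::fd_hilbert) \<Rightarrow> 'b \<Rightarrow> 'a"
  where "adj f = (THE g. \<forall>x y. cinner (g x) y = cinner x (f y))"

lemma adj_unique:
  assumes "\<And>x y. cinner (g x) y = cinner x (f y)"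
  shows "adj f = g"
  unfolding adj_def
proof (rule the_equality)
  fix h assume h: "\<forall>x y. cinner (h x) y = cinner x (f y)"
  show "h = g"
  proof
    fix x
    show "h x = g x" by (rule cinner_ext_left) (simp add: h assms)
  qed
qed (use assms in auto)

lemma adj_cinner_left:
  assumes f: "clinear f"
  shows "cinner (adj f x) y = cinner x (f y)"
proof -
  define g where "g = (\<lambda>x. \<Sum>e\<in>onb. cinner (f e) x *\<^sub>C e)"
  have "cinner (g x) y = cinner x (f y)" for x y
  proof -
    have "cinner x (f y) = cinner x (f (\<Sum>e\<in>onb. cinner e y *\<^sub>C e))"
      by (simp add: onb_expand)
    also have "\<dots> = (\<Sum>e\<in>onb. cinner e y * cinner x (f e))"
      by (simp add: clinear_sum[OF f] clinear_scale[OF f] cinner_sum_right cinner_scaleC_right)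
    also have "\<dots> = cinner (g x) y"
      unfolding g_def
      by (auto simp: cinner_sum_left cinner_scaleC_left mult.commute
          cinner_commute[symmetric] intro!: sum.cong)
    finally show ?thesis by simp
  qed
  then show ?thesis using adj_unique[of g f] by simp
qed

section \<open>Tensor products\<close>

text \<open>The tensor product of \<open>'a\<close> and \<open>'b\<close> is realised as the space of functions
  \<open>'a \<Rightarrow> 'b \<Rightarrow> complex\<close> that are conjugate-linear in each argument, the elementary tensor of
  \<open>a\<close> and \<open>b\<close> being \<open>\<lambda>x y. cinner x a * cinner y b\<close>. The lemmas \<open>tlift_otimes\<close>,
  \<open>clinear_tlift\<close>, \<open>tensor_ext\<close> (universal property) and \<open>cinner_otimes\<close> characterise it up to
  unique unitary isomorphism.\<close>

typedef (overloaded) ('a::fd_hilbert, 'b::fd_hilbert) tensor =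
  "{f :: 'a \<Rightarrow> 'b \<Rightarrow> complex.
      (\<forall>y. clinear (\<lambda>x. cnj (f x y))) \<and> (\<forall>x. clinear (\<lambda>y. cnj (f x y)))}"
  by (rule exI[of _ "\<lambda>_ _. 0"]) (auto intro!: clinearI)

type_notation tensor (infixr \<open>\<otimes>\<close> 75)

setup_lifting type_definition_tensor

instantiation tensor :: (fd_hilbert, fd_hilbert) complex_vector
begin

lift_definition zero_tensor :: "'a \<otimes> 'b" is "\<lambda>_ _. 0"
  by (auto intro!: clinearI)

lift_definition plus_tensor :: "'a \<otimes> 'b \<Rightarrow> 'a \<otimes> 'b \<Rightarrow> 'a \<otimes> 'b" is "\<lambda>f g x y. f x y + g x y"
  unfolding clinear_iff by (auto simp: algebra_simps)

lift_definition minus_tensor :: "'a \<otimes> 'b \<Rightarrow> 'a \<otimes> 'b \<Rightarrow> 'a \<otimes> 'b" is "\<lambda>f g x y. f x y - g x y"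
  unfolding clinear_iff by (auto simp: algebra_simps)

lift_definition uminus_tensor :: "'a \<otimes> 'b \<Rightarrow> 'a \<otimes> 'b" is "\<lambda>f x y. - f x y"
  unfolding clinear_iff by (auto simp: algebra_simps)

lift_definition scaleC_tensor :: "complex \<Rightarrow> 'a \<otimes> 'b \<Rightarrow> 'a \<otimes> 'b" is "\<lambda>c f x y. c * f x y"
  unfolding clinear_iff by (auto simp: algebra_simps)

instance
  by standard (transfer; auto simp: algebra_simps)+

end

lift_definition otimes :: "'a::fd_hilbert \<Rightarrow> 'b::fd_hilbert \<Rightarrow> 'a \<otimes> 'b"  (infixr \<open>\<otimes>\<close> 75)
  is "\<lambda>a b x y. cinner x a * cinner y b"
  unfolding clinear_iff
  by (auto simp: cinner_add_left cinner_scaleC_left algebra_simps)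

lemma Rep_tensor_sum:
  "Rep_tensor (\<Sum>i\<in>I. T i) x y = (\<Sum>i\<in>I. Rep_tensor (T i) x y)"
  by (induction I rule: infinite_finite_induct)
    (auto simp: zero_tensor.rep_eq plus_tensor.rep_eq)

lemma Rep_tensor_conj_linear:
  "Rep_tensor T (x + x') y = Rep_tensor T x y + Rep_tensor T x' y"
  "Rep_tensor T x (y + y') = Rep_tensor T x y + Rep_tensor T x y'"
  "Rep_tensor T (c *\<^sub>C x) y = cnj c * Rep_tensor T x y"
  "Rep_tensor T x (c *\<^sub>C y) = cnj c * Rep_tensor T x y"
proof -
  have *: "clinear (\<lambda>x. cnj (Rep_tensor T x y))" "clinear (\<lambda>y. cnj (Rep_tensor T x y))" for x y
    using Rep_tensor[of T] by auto
  have "cnj (Rep_tensor T (x + x') y) = cnj (Rep_tensor T x y + Rep_tensor T x' y)"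
    "cnj (Rep_tensor T x (y + y')) = cnj (Rep_tensor T x y + Rep_tensor T x y')"
    "cnj (Rep_tensor T (c *\<^sub>C x) y) = cnj (cnj c * Rep_tensor T x y)"
    "cnj (Rep_tensor T x (c *\<^sub>C y)) = cnj (cnj c * Rep_tensor T x y)"
    using *(1)[of y] *(2)[of x] unfolding clinear_iff by auto
  then show "Rep_tensor T (x + x') y = Rep_tensor T x y + Rep_tensor T x' y"
    "Rep_tensor T x (y + y') = Rep_tensor T x y + Rep_tensor T x y'"
    "Rep_tensor T (c *\<^sub>C x) y = cnj c * Rep_tensor T x y"
    "Rep_tensor T x (c *\<^sub>C y) = cnj c * Rep_tensor T x y"
    by (simp_all only: complex_cnj_cancel_iff)
qed

lemma Rep_tensor_sum_left:
  "Rep_tensor T (\<Sum>i\<in>I. c i *\<^sub>C f i) y = (\<Sum>i\<in>I. cnj (c i) * Rep_tensor T (f i) y)"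
proof -
  have "Rep_tensor T 0 y = 0" using Rep_tensor_conj_linear(3)[of T 0 0 y] by simp
  then show ?thesis
    by (induction I rule: infinite_finite_induct) (auto simp: Rep_tensor_conj_linear)
qed

lemma Rep_tensor_sum_right:
  "Rep_tensor T x (\<Sum>i\<in>I. c i *\<^sub>C f i) = (\<Sum>i\<in>I. cnj (c i) * Rep_tensor T x (f i))"
proof -
  have "Rep_tensor T x 0 = 0" using Rep_tensor_conj_linear(4)[of T x 0 0] by simp
  then show ?thesis
    by (induction I rule: infinite_finite_induct) (auto simp: Rep_tensor_conj_linear)
qed

lemma tensor_expand:
  fixes T :: "'a::fd_hilbert \<otimes> 'b::fd_hilbert"
  shows "T = (\<Sum>e\<in>onb. \<Sum>e'\<in>onb. Rep_tensor T e e' *\<^sub>C (e \<otimes> e'))"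
proof -
  have "Rep_tensor T x y =
      Rep_tensor (\<Sum>e\<in>onb. \<Sum>e'\<in>onb. Rep_tensor T e e' *\<^sub>C (e \<otimes> e')) x y" for x y
  proof -
    have "Rep_tensor T x y =
        Rep_tensor T (\<Sum>e\<in>onb. cinner e x *\<^sub>C e) (\<Sum>e\<in>onb. cinner e y *\<^sub>C e)"
      by (simp add: onb_expand)
    also have "\<dots> = (\<Sum>e\<in>onb. \<Sum>e'\<in>onb. Rep_tensor T e e' * (cinner x e * cinner y e'))"
      by (subst Rep_tensor_sum_left)
        (simp only: Rep_tensor_sum_right cinner_commute[symmetric]
          sum_distrib_left mult_ac)
    also have "\<dots> = Rep_tensor (\<Sum>e\<in>onb. \<Sum>e'\<in>onb. Rep_tensor T e e' *\<^sub>C (e \<otimes> e')) x y"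
      by (simp add: Rep_tensor_sum scaleC_tensor.rep_eq otimes.rep_eq)
    finally show ?thesis .
  qed
  then show ?thesis by (intro iffD1[OF Rep_tensor_inject] ext)
qed

instantiation tensor :: (fd_hilbert, fd_hilbert) fd_hilbert
begin

definition cinner_tensor :: "'a \<otimes> 'b \<Rightarrow> 'a \<otimes> 'b \<Rightarrow> complex"
  where "cinner_tensor S T = (\<Sum>e\<in>onb. \<Sum>e'\<in>onb. cnj (Rep_tensor S e e') * Rep_tensor T e e')"

instance
proof
  fix x y z :: "'a \<otimes> 'b" and c :: complex
  show "cinner x y = cnj (cinner y x)"
    by (simp add: cinner_tensor_def mult.commute)
  show "cinner x (y + z) = cinner x y + cinner x z"
    by (simp add: cinner_tensor_def plus_tensor.rep_eq algebra_simps sum.distrib)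
  show "cinner x (c *\<^sub>C y) = c * cinner x y"
    by (simp add: cinner_tensor_def scaleC_tensor.rep_eq sum_distrib_left mult_ac)
  have norm: "cinner x x =
      of_real (\<Sum>e\<in>onb. \<Sum>e'\<in>onb. (cmod (Rep_tensor x e e'))\<^sup>2)"
    unfolding cinner_tensor_def of_real_sum complex_norm_square by (simp add: mult.commute)
  show "0 \<le> Re (cinner x x)"
    unfolding norm by (simp add: sum_nonneg)
  show "cinner x x = 0 \<longleftrightarrow> x = 0"
  proof
    assume "cinner x x = 0"
    then have "(\<Sum>e\<in>onb. \<Sum>e'\<in>onb. (cmod (Rep_tensor x e e'))\<^sup>2) = 0"
      unfolding norm of_real_eq_0_iff .
    then have "Rep_tensor x e e' = 0" if "e \<in> onb" "e' \<in> onb" for e e'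
      using that by (auto simp: sum_nonneg_eq_0_iff sum_nonneg)
    then have "(\<Sum>e\<in>onb. \<Sum>e'\<in>onb. Rep_tensor x e e' *\<^sub>C (e \<otimes> e')) = 0"
      by simp
    then show "x = 0" using tensor_expand[of x] by simp
  qed (simp add: cinner_tensor_def zero_tensor.rep_eq)
  let ?B = "(\<lambda>(e, e'). e \<otimes> e') ` (onb \<times> onb) :: ('a \<otimes> 'b) set"
  have "\<exists>c. x = (\<Sum>b\<in>?B. c b *\<^sub>C b)" for x :: "'a \<otimes> 'b"
  proof -
    have "x \<in> cvec.span ?B"
      by (subst tensor_expand[of x], intro cvec.span_sum cvec.span_scale cvec.span_base) auto
    then show ?thesis by (subst (asm) cvec.span_finite) auto
  qed
  then show "\<exists>B. finite B \<and> (\<forall>x :: 'a \<otimes> 'b. \<exists>c. x = (\<Sum>b\<in>B. c b *\<^sub>C b))"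
    by (intro exI[of _ ?B]) auto
qed

end

lemma cinner_otimes: "cinner (a \<otimes> b) (c \<otimes> d) = cinner a c * cinner b d"
proof -
  have parseval: "(\<Sum>e\<in>onb. cinner a e * cinner e c) = cinner a c" for a c :: "'c::fd_hilbert"
  proof -
    have "cinner a c = cinner a (\<Sum>e\<in>onb. cinner e c *\<^sub>C e)" by (simp add: onb_expand)
    then show ?thesis by (simp add: cinner_sum_right cinner_scaleC_right mult.commute)
  qed
  have "cinner (a \<otimes> b) (c \<otimes> d) =
      (\<Sum>e\<in>onb. \<Sum>e'\<in>onb. (cinner a e * cinner e c) * (cinner b e' * cinner e' d))"
    by (simp add: cinner_tensor_def otimes.rep_eq cinner_commute[symmetric] mult_ac)
  also have "\<dots> = cinner a c * cinner b d"
    by (simp add: parseval flip: sum_distrib_left sum_distrib_right)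
  finally show ?thesis .
qed

definition cbilinear :: "('a::complex_vector \<Rightarrow> 'b::complex_vector \<Rightarrow> 'c::complex_vector) \<Rightarrow> bool"
  where "cbilinear h \<longleftrightarrow> (\<forall>b. clinear (\<lambda>a. h a b)) \<and> (\<forall>a. clinear (h a))"

lemma cbilinear_otimes: "cbilinear (\<otimes>)"
  unfolding cbilinear_def clinear_iff
  by (intro conjI allI; transfer;
      auto simp: cinner_add_right cinner_scaleC_right algebra_simps)

text \<open>The linear map on the tensor product induced by a bilinear map.\<close>

definition tlift :: "('a::fd_hilbert \<Rightarrow> 'b::fd_hilbert \<Rightarrow> 'c::complex_vector) \<Rightarrow> 'a \<otimes> 'b \<Rightarrow> 'c"
  where "tlift h T = (\<Sum>e\<in>onb. \<Sum>e'\<in>onb. Rep_tensor T e e' *\<^sub>C h e e')"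

lemma clinear_tlift: "clinear (tlift h)"
  by (rule clinearI)
    (auto simp: tlift_def plus_tensor.rep_eq scaleC_tensor.rep_eq scaleC_add_left sum.distrib
      cvec.scale_sum_right)

lemma tlift_otimes:
  assumes "cbilinear h"
  shows "tlift h (a \<otimes> b) = h a b"
proof -
  have l: "clinear (\<lambda>a. h a b)" and r: "clinear (h a)" for a b
    using assms by (auto simp: cbilinear_def)
  have "h a b = h (\<Sum>e\<in>onb. cinner e a *\<^sub>C e) (\<Sum>e\<in>onb. cinner e b *\<^sub>C e)"
    by (simp add: onb_expand)
  also have "\<dots> = (\<Sum>e\<in>onb. cinner e a *\<^sub>C h e (\<Sum>e\<in>onb. cinner e b *\<^sub>C e))"
    by (simp add: clinear_sum[OF l] clinear_scale[OF l])
  also have "\<dots> = tlift h (a \<otimes> b)"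
    by (simp add: tlift_def otimes.rep_eq clinear_sum[OF r] clinear_scale[OF r]
        cvec.scale_sum_right)
  finally show ?thesis by simp
qed

lemma tensor_ext:
  fixes f g :: "'a::fd_hilbert \<otimes> 'b::fd_hilbert \<Rightarrow> 'c::complex_vector"
  assumes "clinear f" "clinear g" and "\<And>a b. f (a \<otimes> b) = g (a \<otimes> b)"
  shows "f = g"
proof
  fix T
  have "h T = (\<Sum>e\<in>onb. \<Sum>e'\<in>onb. Rep_tensor T e e' *\<^sub>C h (e \<otimes> e'))" if "clinear h"
    for h :: "'a \<otimes> 'b \<Rightarrow> 'c"
  proof -
    have "h T = h (\<Sum>e\<in>onb. \<Sum>e'\<in>onb. Rep_tensor T e e' *\<^sub>C (e \<otimes> e'))"
      by (rule arg_cong[OF tensor_expand])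
    then show ?thesis by (simp add: clinear_sum[OF that] clinear_scale[OF that])
  qed
  from this[OF assms(1)] this[OF assms(2)] show "f T = g T"
    by (simp add: assms(3))
qed

definition tmap :: "('a::fd_hilbert \<Rightarrow> 'c::fd_hilbert) \<Rightarrow> ('b::fd_hilbert \<Rightarrow> 'd::fd_hilbert)
    \<Rightarrow> 'a \<otimes> 'b \<Rightarrow> 'c \<otimes> 'd"  (infixr \<open>\<otimes>\<^sub>o\<close> 75)
  where "f \<otimes>\<^sub>o g = tlift (\<lambda>a b. f a \<otimes> g b)"

definition assoc :: "('a::fd_hilbert \<otimes> 'b::fd_hilbert) \<otimes> 'c::fd_hilbert \<Rightarrow> 'a \<otimes> ('b \<otimes> 'c)"
  where "assoc = tlift (\<lambda>t c. tlift (\<lambda>a b. a \<otimes> (b \<otimes> c)) t)"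

definition assoc_inv :: "'a::fd_hilbert \<otimes> ('b::fd_hilbert \<otimes> 'c::fd_hilbert) \<Rightarrow> ('a \<otimes> 'b) \<otimes> 'c"
  where "assoc_inv = tlift (\<lambda>a. tlift (\<lambda>b c. (a \<otimes> b) \<otimes> c))"

definition swap :: "'a::fd_hilbert \<otimes> 'b::fd_hilbert \<Rightarrow> 'b \<otimes> 'a"
  where "swap = tlift (\<lambda>a b. b \<otimes> a)"

definition lunit :: "complex \<otimes> 'a::fd_hilbert \<Rightarrow> 'a"
  where "lunit = tlift (\<lambda>c a. c *\<^sub>C a)"

definition lunit_inv :: "'a::fd_hilbert \<Rightarrow> complex \<otimes> 'a"
  where "lunit_inv a = 1 \<otimes> a"

definition runit :: "'a::fd_hilbert \<otimes> complex \<Rightarrow> 'a"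
  where "runit = tlift (\<lambda>a c. c *\<^sub>C a)"

definition runit_inv :: "'a::fd_hilbert \<Rightarrow> 'a \<otimes> complex"
  where "runit_inv a = a \<otimes> 1"

lemma otimes_linear:
  fixes a a' :: "'a::fd_hilbert" and b b' :: "'b::fd_hilbert"
  shows "(a + a') \<otimes> b = a \<otimes> b + a' \<otimes> b" "a \<otimes> (b + b') = a \<otimes> b + a \<otimes> b'"
  "(c *\<^sub>C a) \<otimes> b = c *\<^sub>C (a \<otimes> b)" "a \<otimes> (c *\<^sub>C b) = c *\<^sub>C (a \<otimes> b)"
  using cbilinear_otimes[where 'a = 'a and 'b = 'b] unfolding cbilinear_def clinear_iff by auto

lemma tlift_linear:
  "tlift h (S + T) = tlift h S + tlift h T" "tlift h (c *\<^sub>C T) = c *\<^sub>C tlift h T"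
  using clinear_tlift[of h] unfolding clinear_iff by auto

lemma tlift_fun_linear:
  "tlift (\<lambda>a b. h a b + k a b) T = tlift h T + tlift k T"
  "tlift (\<lambda>a b. c *\<^sub>C h a b) T = c *\<^sub>C tlift h T"
  by (auto simp: tlift_def scaleC_add_right sum.distrib cvec.scale_sum_right mult.commute)

lemma tmap_otimes: "clinear f \<Longrightarrow> clinear g \<Longrightarrow> (f \<otimes>\<^sub>o g) (a \<otimes> b) = f a \<otimes> g b"
  unfolding tmap_def
  by (subst tlift_otimes) (auto simp: cbilinear_def clinear_iff otimes_linear)

lemma assoc_otimes: "assoc ((a \<otimes> b) \<otimes> c) = a \<otimes> (b \<otimes> c)"
  unfolding assoc_def
  by (subst tlift_otimes, force simp: cbilinear_def clinear_iff otimes_linear tlift_linear tlift_fun_linear)+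
    simp

lemma assoc_inv_otimes: "assoc_inv (a \<otimes> (b \<otimes> c)) = (a \<otimes> b) \<otimes> c"
proof -
  have 1: "cbilinear (\<lambda>a. tlift (\<lambda>b c. (a \<otimes> b) \<otimes> c))"
    by (simp add: cbilinear_def clinear_tlift)
      (simp add: clinear_iff tlift_def otimes_linear scaleC_add_right sum.distrib
        cvec.scale_sum_right mult_ac)
  have 2: "cbilinear (\<lambda>b c. (a \<otimes> b) \<otimes> c)"
    by (simp add: cbilinear_def clinear_iff otimes_linear)
  show ?thesis unfolding assoc_inv_def tlift_otimes[OF 1] tlift_otimes[OF 2] ..
qed

lemma swap_otimes: "swap (a \<otimes> b) = b \<otimes> a"
  unfolding swap_def
  by (subst tlift_otimes) (auto simp: cbilinear_def clinear_iff otimes_linear)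

lemma lunit_otimes: "lunit (c \<otimes> a) = c *\<^sub>C a"
  unfolding lunit_def
  by (subst tlift_otimes)
    (auto simp: cbilinear_def clinear_iff scaleC_add_left scaleC_add_right mult.commute)

lemma runit_otimes: "runit (a \<otimes> c) = c *\<^sub>C a"
  unfolding runit_def
  by (subst tlift_otimes)
    (auto simp: cbilinear_def clinear_iff scaleC_add_left scaleC_add_right mult.commute)

section \<open>Quantum sets, graphs and relations\<close>

text \<open>A quantum set is given by a type \<open>'a\<close> with a multiplication \<open>m\<close> and a unit \<open>u\<close>;
  the comultiplication is \<open>adj m\<close> and the counit is \<open>adj u\<close>.\<close>

definition quantum_set :: "('a::fd_hilbert \<otimes> 'a \<Rightarrow> 'a) \<Rightarrow> (complex \<Rightarrow> 'a) \<Rightarrow> bool"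
  where "quantum_set m u \<longleftrightarrow>
    clinear m \<and> clinear u \<and>
    m \<circ> (m \<otimes>\<^sub>o id) = m \<circ> (id \<otimes>\<^sub>o m) \<circ> assoc \<and>
    m \<circ> (u \<otimes>\<^sub>o id) = lunit \<and>
    m \<circ> (id \<otimes>\<^sub>o u) = runit \<and>
    (m \<otimes>\<^sub>o id) \<circ> assoc_inv \<circ> (id \<otimes>\<^sub>o adj m) = adj m \<circ> m \<and>
    (id \<otimes>\<^sub>o m) \<circ> assoc \<circ> (adj m \<otimes>\<^sub>o id) = adj m \<circ> m \<and>
    m \<circ> adj m = id \<and>
    adj u \<circ> m \<circ> swap = adj u \<circ> m"

definition cup :: "('a::fd_hilbert \<otimes> 'a \<Rightarrow> 'a) \<Rightarrow> (complex \<Rightarrow> 'a) \<Rightarrow> complex \<Rightarrow> 'a \<otimes> 'a"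
  where "cup m u = adj m \<circ> u"

definition cap :: "('a::fd_hilbert \<otimes> 'a \<Rightarrow> 'a) \<Rightarrow> (complex \<Rightarrow> 'a) \<Rightarrow> 'a \<otimes> 'a \<Rightarrow> complex"
  where "cap m u = adj u \<circ> m"

text \<open>Bending both legs of an endomorphism of \<open>'h\<close> with a given cup \<open>n\<close> and cap \<open>c\<close>:
  \<open>(id \<otimes> c)(id \<otimes> F \<otimes> id)(n \<otimes> id)\<close>.\<close>

definition rotation ::
  "(complex \<Rightarrow> 'h::fd_hilbert \<otimes> 'h) \<Rightarrow> ('h \<otimes> 'h \<Rightarrow> complex) \<Rightarrow> ('h \<Rightarrow> 'h) \<Rightarrow> 'h \<Rightarrow> 'h"
  where "rotation n c F =
    runit \<circ> (id \<otimes>\<^sub>o c) \<circ> (id \<otimes>\<^sub>o (F \<otimes>\<^sub>o id)) \<circ> assoc \<circ> (n \<otimes>\<^sub>o id) \<circ> lunit_inv"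

definition quantum_graph ::
  "('a::fd_hilbert \<otimes> 'a \<Rightarrow> 'a) \<Rightarrow> (complex \<Rightarrow> 'a) \<Rightarrow> ('a \<Rightarrow> 'a) \<Rightarrow> bool"
  where "quantum_graph m u G \<longleftrightarrow>
    quantum_set m u \<and> clinear G \<and> adj G = G \<and>
    m \<circ> (G \<otimes>\<^sub>o G) \<circ> adj m = G \<and>
    rotation (cup m u) (cap m u) G = G"

definition reflexive_quantum_graph ::
  "('a::fd_hilbert \<otimes> 'a \<Rightarrow> 'a) \<Rightarrow> (complex \<Rightarrow> 'a) \<Rightarrow> ('a \<Rightarrow> 'a) \<Rightarrow> bool"
  where "reflexive_quantum_graph m u G \<longleftrightarrow>
    quantum_graph m u G \<and> m \<circ> (G \<otimes>\<^sub>o id) \<circ> adj m = id"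

definition projector :: "('h::fd_hilbert \<Rightarrow> 'h) \<Rightarrow> bool"
  where "projector P \<longleftrightarrow> clinear P \<and> adj P = P \<and> P \<circ> P = P"

text \<open>Rebracketing of the fourfold tensor product around its two middle factors.\<close>

definition rebracket ::
  "('a::fd_hilbert \<otimes> 'b::fd_hilbert) \<otimes> ('c::fd_hilbert \<otimes> 'd::fd_hilbert) \<Rightarrow> 'a \<otimes> (('b \<otimes> 'c) \<otimes> 'd)"
  where "rebracket = (id \<otimes>\<^sub>o assoc_inv) \<circ> assoc"

definition rebracket_inv ::
  "'a::fd_hilbert \<otimes> (('b::fd_hilbert \<otimes> 'c::fd_hilbert) \<otimes> 'd::fd_hilbert) \<Rightarrow> ('a \<otimes> 'b) \<otimes> ('c \<otimes> 'd)"
  where "rebracket_inv = assoc_inv \<circ> (id \<otimes>\<^sub>o assoc)"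

definition quantum_relation ::
  "('a::fd_hilbert \<otimes> 'a \<Rightarrow> 'a) \<Rightarrow> (complex \<Rightarrow> 'a) \<Rightarrow> ('a \<otimes> 'a \<Rightarrow> 'a \<otimes> 'a) \<Rightarrow> bool"
  where "quantum_relation m u P \<longleftrightarrow>
    quantum_set m u \<and> projector P \<and>
    P \<circ> (m \<otimes>\<^sub>o m) = (m \<otimes>\<^sub>o m) \<circ> rebracket_inv \<circ> (id \<otimes>\<^sub>o (P \<otimes>\<^sub>o id)) \<circ> rebracket"

text \<open>Nested cup and cap for two parallel wires; \<open>cap2 m u\<close> is the bilinear form
  \<open>\<beta>\<^sub>2\<close> sending \<open>(a \<otimes> b) \<otimes> (c \<otimes> d)\<close> to \<open>\<epsilon> (m (a \<otimes> d)) * \<epsilon> (m (b \<otimes> c))\<close>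
  with \<open>\<epsilon> = adj u\<close>.\<close>

definition cup2 ::
  "('a::fd_hilbert \<otimes> 'a \<Rightarrow> 'a) \<Rightarrow> (complex \<Rightarrow> 'a) \<Rightarrow> complex \<Rightarrow> ('a \<otimes> 'a) \<otimes> ('a \<otimes> 'a)"
  where "cup2 m u = rebracket_inv \<circ> (id \<otimes>\<^sub>o (cup m u \<otimes>\<^sub>o id)) \<circ> (id \<otimes>\<^sub>o lunit_inv) \<circ> cup m u"

definition cap2 ::
  "('a::fd_hilbert \<otimes> 'a \<Rightarrow> 'a) \<Rightarrow> (complex \<Rightarrow> 'a) \<Rightarrow> ('a \<otimes> 'a) \<otimes> ('a \<otimes> 'a) \<Rightarrow> complex"
  where "cap2 m u = cap m u \<circ> (id \<otimes>\<^sub>o lunit) \<circ> (id \<otimes>\<^sub>o (cap m u \<otimes>\<^sub>o id)) \<circ> rebracket"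

definition symmetric_relation ::
  "('a::fd_hilbert \<otimes> 'a \<Rightarrow> 'a) \<Rightarrow> (complex \<Rightarrow> 'a) \<Rightarrow> ('a \<otimes> 'a \<Rightarrow> 'a \<otimes> 'a) \<Rightarrow> bool"
  where "symmetric_relation m u P \<longleftrightarrow> rotation (cup2 m u) (cap2 m u) P = P"

definition reflexive_relation ::
  "('a::fd_hilbert \<otimes> 'a \<Rightarrow> 'a) \<Rightarrow> (complex \<Rightarrow> 'a) \<Rightarrow> ('a \<otimes> 'a \<Rightarrow> 'a \<otimes> 'a) \<Rightarrow> bool"
  where "reflexive_relation m u P \<longleftrightarrow> P \<circ> adj m \<circ> u = adj m \<circ> u"

definition relation_of_graph ::
  "('a::fd_hilbert \<otimes> 'a \<Rightarrow> 'a) \<Rightarrow> ('a \<Rightarrow> 'a) \<Rightarrow> 'a \<otimes> 'a \<Rightarrow> 'a \<otimes> 'a"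
  where "relation_of_graph m G =
    (m \<otimes>\<^sub>o id) \<circ> assoc_inv \<circ> (id \<otimes>\<^sub>o (G \<otimes>\<^sub>o id)) \<circ> (id \<otimes>\<^sub>o adj m)"

definition graph_of_relation ::
  "(complex \<Rightarrow> 'a::fd_hilbert) \<Rightarrow> ('a \<otimes> 'a \<Rightarrow> 'a \<otimes> 'a) \<Rightarrow> 'a \<Rightarrow> 'a"
  where "graph_of_relation u P = lunit \<circ> (adj u \<otimes>\<^sub>o id) \<circ> P \<circ> (id \<otimes>\<^sub>o u) \<circ> runit_inv"

lemma clinear_structural [simp, intro]:
  "clinear (id :: 'a::fd_hilbert \<Rightarrow> 'a)" "clinear (f \<otimes>\<^sub>o g)" "clinear assoc" "clinear assoc_inv"
  "clinear swap" "clinear lunit" "clinear runit" "clinear lunit_inv" "clinear runit_inv"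
  by (auto simp: tmap_def assoc_def assoc_inv_def swap_def lunit_def runit_def clinear_tlift
      lunit_inv_def runit_inv_def otimes_linear intro: clinearI)

lemma clinear_adj [intro]:
  assumes "clinear f" shows "clinear (adj f)"
  by (rule clinearI; rule cinner_ext_left;
      simp add: adj_cinner_left[OF assms] cinner_add_left cinner_scaleC_left)

lemma clinear_comp [intro]: "clinear f \<Longrightarrow> clinear g \<Longrightarrow> clinear (g \<circ> f)"
  by (auto simp: clinear_iff)

lemma cap2_otimes:
  assumes "clinear m" "clinear u"
  shows "cap2 m u ((a \<otimes> b) \<otimes> (c \<otimes> d)) = adj u (m (a \<otimes> d)) * adj u (m (b \<otimes> c))"
proof -
  have c: "clinear (cap m u)" "clinear (adj u)"
    using assms by (auto simp: cap_def)
  have "cap2 m u ((a \<otimes> b) \<otimes> (c \<otimes> d)) = cap m u (a \<otimes> (cap m u (b \<otimes> c) *\<^sub>C d))"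
    by (simp add: cap2_def rebracket_def assoc_otimes tmap_otimes assoc_inv_otimes lunit_otimes c)
  also have "\<dots> = cap m u (b \<otimes> c) * cap m u (a \<otimes> d)"
    by (simp add: otimes_linear clinear_scale[OF c(1)])
  finally show ?thesis by (simp add: cap_def mult.commute)
qed

end

theory Submission
  imports Defs
begin

text \<open>
  Write \<open>\<Delta> 1 = \<Sum>\<^sub>e e\<^sup>* \<otimes> e\<close>, summed over an orthonormal basis. The Frobenius law lets \<open>b\<close> move
  across this Casimir element, so that \<open>P\<^sub>G (a \<otimes> b) = \<Sum>\<^sub>e a G(e\<^sup>*) \<otimes> e b\<close> and
  \<open>P\<^sub>G \<circ> P\<^sub>F = P\<^sub>H\<close> with \<open>H = m (F \<otimes> G) \<Delta>\<close>. As \<open>G\<close> can be read off \<open>P\<^sub>G (1 \<otimes> 1)\<close>, for symmetric \<open>G\<close> each axiom of a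
  reflexive quantum graph is equivalent to the corresponding property of the bimodule map \<open>P\<^sub>G\<close>.
  Conversely, a bimodule map \<open>P\<close> is determined by \<open>P (1 \<otimes> 1)\<close>, and its symmetry identifies
  \<open>\<beta>\<^sub>2 (P (1 \<otimes> 1), c \<otimes> d)\<close> with \<open>(\<epsilon> \<otimes> \<epsilon>) P (c \<otimes> d) = \<epsilon> (G(c) d)\<close>; nondegeneracy of \<open>\<beta>\<^sub>2\<close> gives
  \<open>P = P\<^sub>G\<close>.
\<close>

section \<open>Linear algebra\<close>

lemma clinear_compose: "clinear f \<Longrightarrow> clinear g \<Longrightarrow> clinear (\<lambda>x. g (f x))"
  by (auto simp: clinear_iff)

lemma clinear_otimes [simp, intro]: "clinear ((\<otimes>) a)" "clinear (\<lambda>a. a \<otimes> b)"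
  by (auto simp: clinear_iff otimes_linear)

lemma otimes_sum_right: "a \<otimes> (\<Sum>i\<in>I. f i) = (\<Sum>i\<in>I. a \<otimes> f i)"
  by (rule clinear_sum) simp

lemma otimes_sum_left: "(\<Sum>i\<in>I. f i) \<otimes> b = (\<Sum>i\<in>I. f i \<otimes> b)"
  by (rule clinear_sum[of "\<lambda>a. a \<otimes> b"]) simp

text \<open>\<open>tensor_ext\<close> is applied in one argument at a time. This reduces identities
  of maps on a fourfold tensor product to elementary tensors.\<close>

lemma cbilinear_tensor_ext:
  fixes f g :: "'a::fd_hilbert \<otimes> 'b::fd_hilbert \<Rightarrow> 'c::fd_hilbert \<otimes> 'd::fd_hilbert
    \<Rightarrow> 'e::complex_vector"
  assumes f: "cbilinear f" and g: "cbilinear g"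
    and eq: "\<And>a b c d. f (a \<otimes> b) (c \<otimes> d) = g (a \<otimes> b) (c \<otimes> d)"
  shows "f = g"
proof -
  have 1: "f (a \<otimes> b) = g (a \<otimes> b)" for a b
    using f g eq by (intro tensor_ext) (auto simp: cbilinear_def)
  have "(\<lambda>x. f x y) = (\<lambda>x. g x y)" for y
    using f g 1 by (intro tensor_ext) (auto simp: cbilinear_def)
  then show ?thesis by (metis ext)
qed

lemma adj_eq_self_iff:
  assumes "clinear f"
  shows "adj f = f \<longleftrightarrow> (\<forall>x y. cinner (f x) y = cinner x (f y))"
  using adj_cinner_left[OF assms] adj_unique[of f f] by metis

lemma adj_tensor_eq_self_iff:
  fixes F :: "'a::fd_hilbert \<otimes> 'b::fd_hilbert \<Rightarrow> 'a \<otimes> 'b"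
  assumes F: "clinear F"
  shows "adj F = F \<longleftrightarrow>
    (\<forall>a b c d. cinner (F (a \<otimes> b)) (c \<otimes> d) = cinner (a \<otimes> b) (F (c \<otimes> d)))"
proof
  assume *: "\<forall>a b c d. cinner (F (a \<otimes> b)) (c \<otimes> d) = cinner (a \<otimes> b) (F (c \<otimes> d))"
  have 1: "cinner (F (a \<otimes> b)) = (\<lambda>y. cinner (a \<otimes> b) (F y))" for a b
    using * by (intro tensor_ext clinear_cinner_right clinear_compose[OF F]) auto
  \<comment> \<open>\<open>cinner\<close> is conjugate-linear on the left, so before the second
    extension from elementary tensors the varying vector is brought to the right by conjugate
    symmetry.\<close>
  have "(\<lambda>x. cinner y (F x)) = cinner (F y)" for y
  proof (intro tensor_ext clinear_cinner_right clinear_compose[OF F])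
    show "cinner y (F (a \<otimes> b)) = cinner (F y) (a \<otimes> b)" for a b
      using fun_cong[OF 1, of a b y] by (metis cinner_commute)
  qed
  then show "adj F = F"
    by (subst adj_eq_self_iff[OF F]) metis
qed (use adj_eq_self_iff[OF F] in blast)

section \<open>Rotation by a nondegenerate pairing\<close>

text \<open>\<open>lunit_inv h\<close> is \<open>1 \<otimes> h\<close>, so only \<open>n 1\<close>
  matters: \<open>F\<close> acts on the legs \<open>y i\<close>, which are then paired with
  \<open>h\<close>, and the legs \<open>x i\<close> survive.\<close>

lemma rotation_apply:
  assumes n: "clinear n" "n 1 = (\<Sum>i\<in>I. x i \<otimes> y i)" and c: "clinear c" and F: "clinear F"
  shows "rotation n c F h = (\<Sum>i\<in>I. c (F (y i) \<otimes> h) *\<^sub>C x i)"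
proof -
  have "assoc ((n \<otimes>\<^sub>o id) (lunit_inv h)) = (\<Sum>i\<in>I. x i \<otimes> (y i \<otimes> h))"
    by (simp add: lunit_inv_def tmap_otimes n otimes_sum_left clinear_sum assoc_otimes)
  then show ?thesis
    by (simp add: rotation_def clinear_sum tmap_otimes c F runit_otimes)
qed

text \<open>\<open>rotation n c F\<close> is the transpose of \<open>F\<close> for the pairing
  \<open>c\<close>. The first zigzag identity gives the transposition rule, the second makes
  \<open>c\<close> nondegenerate. Cup and cap are left arbitrary so that one wire and two parallel
  wires are treated alike.\<close>

lemma rotation_eq_self_iff:
  assumes n: "clinear n" "n 1 = (\<Sum>i\<in>I. x i \<otimes> y i)" and c: "clinear c" and F: "clinear F"
    and zigzag: "\<And>z. (\<Sum>i\<in>I. c (z \<otimes> x i) *\<^sub>C y i) = z"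
      "\<And>h. (\<Sum>i\<in>I. c (y i \<otimes> h) *\<^sub>C x i) = h"
  shows "rotation n c F = F \<longleftrightarrow> (\<forall>z h. c (F z \<otimes> h) = c (z \<otimes> F h))"
proof -
  have lin: "clinear (\<lambda>h. c (z \<otimes> h))" "clinear (\<lambda>z. c (F z \<otimes> h))" for z h
    using c F by (auto simp: clinear_iff otimes_linear)
  have rot: "c (z \<otimes> rotation n c F h) = c (F z \<otimes> h)" for z h
  proof -
    have "c (z \<otimes> rotation n c F h) = (\<Sum>i\<in>I. c (F (y i) \<otimes> h) * c (z \<otimes> x i))"
      unfolding rotation_apply[OF n c F]
      by (simp add: clinear_sum[OF lin(1)] clinear_scale[OF lin(1)])
    also have "\<dots> = c (F (\<Sum>i\<in>I. c (z \<otimes> x i) *\<^sub>C y i) \<otimes> h)"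
      by (simp add: clinear_sum[OF lin(2)] clinear_scale[OF lin(2)] mult.commute)
    finally show ?thesis by (simp only: zigzag(1))
  qed
  have nondeg: "h = h'" if "\<And>z. c (z \<otimes> h) = c (z \<otimes> h')" for h h'
    by (subst (1 2) zigzag(2)[symmetric]) (simp only: that)
  show ?thesis
  proof
    assume "\<forall>z h. c (F z \<otimes> h) = c (z \<otimes> F h)"
    then show "rotation n c F = F" by (intro ext nondeg) (simp add: rot)
  qed (metis rot)
qed

section \<open>Quantum sets\<close>

lemma clinear_cup: "clinear m \<Longrightarrow> clinear u \<Longrightarrow> clinear (cup m u)"
  and clinear_cap: "clinear m \<Longrightarrow> clinear u \<Longrightarrow> clinear (cap m u)"
  by (auto simp: cup_def cap_def)

lemma clinear_cup2: "clinear m \<Longrightarrow> clinear u \<Longrightarrow> clinear (cup2 m u)"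
  and clinear_cap2: "clinear m \<Longrightarrow> clinear u \<Longrightarrow> clinear (cap2 m u)"
  by (auto simp: cup2_def cap2_def rebracket_def rebracket_inv_def intro!: clinear_comp clinear_cup clinear_cap)

lemma clinear_relation_of_graph: "clinear (relation_of_graph m G)"
  by (auto simp: relation_of_graph_def tmap_def intro!: clinear_comp clinear_tlift)

lemma clinear_graph_of_relation:
  "clinear u \<Longrightarrow> clinear P \<Longrightarrow> clinear (graph_of_relation u P)"
  by (auto simp: graph_of_relation_def intro!: clinear_comp)

locale qset =
  fixes m :: "'a::fd_hilbert \<otimes> 'a \<Rightarrow> 'a" and u :: "complex \<Rightarrow> 'a"
  assumes quantum_set: "quantum_set m u"
begin

definition mult :: "'a \<Rightarrow> 'a \<Rightarrow> 'a"  (infixl \<open>\<cdot>\<close> 77)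
  where "a \<cdot> b = m (a \<otimes> b)"

definition unit :: 'a
  where "unit = u 1"

definition counit :: "'a \<Rightarrow> complex"
  where "counit = adj u"

text \<open>The involution of the algebra: the vector that represents the functional
  \<open>b \<mapsto> counit (a \<cdot> b)\<close>. Multiplication by \<open>star a\<close> turns out
  to be adjoint to multiplication by \<open>a\<close>.\<close>

definition star :: "'a \<Rightarrow> 'a"
  where "star a = adj (\<lambda>x. a \<cdot> x) unit"

lemma clinear_m [simp, intro]: "clinear m" and clinear_u [simp, intro]: "clinear u"
  using quantum_set by (auto simp: quantum_set_def)

lemma clinear_mult [simp, intro]: "clinear ((\<cdot>) a)" "clinear (\<lambda>a. a \<cdot> b)"
  using clinear_m unfolding clinear_iff by (auto simp: mult_def otimes_linear)

lemma clinear_counit [simp, intro]: "clinear counit"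
  by (auto simp: counit_def)

lemma mult_linear:
  "(a + b) \<cdot> c = a \<cdot> c + b \<cdot> c" "a \<cdot> (b + c) = a \<cdot> b + a \<cdot> c"
  "(z *\<^sub>C a) \<cdot> b = z *\<^sub>C (a \<cdot> b)" "a \<cdot> (z *\<^sub>C b) = z *\<^sub>C (a \<cdot> b)"
  using clinear_mult[THEN clinear_add] clinear_mult[THEN clinear_scale] by blast+

lemma counit_linear:
  "counit (a + b) = counit a + counit b" "counit (z *\<^sub>C a) = z * counit a"
  using clinear_counit by (auto simp: clinear_iff)

lemma mult_sum_right: "a \<cdot> (\<Sum>i\<in>I. f i) = (\<Sum>i\<in>I. a \<cdot> f i)"
  by (rule clinear_sum) simp

lemma mult_sum_left: "(\<Sum>i\<in>I. f i) \<cdot> b = (\<Sum>i\<in>I. f i \<cdot> b)"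
  by (rule clinear_sum[of "\<lambda>a. a \<cdot> b"]) simp

lemma counit_sum: "counit (\<Sum>i\<in>I. f i) = (\<Sum>i\<in>I. counit (f i))"
  by (rule clinear_sum) simp

lemma mult_assoc: "a \<cdot> b \<cdot> c = a \<cdot> (b \<cdot> c)"
proof -
  have "(m \<circ> (m \<otimes>\<^sub>o id)) ((a \<otimes> b) \<otimes> c) = (m \<circ> (id \<otimes>\<^sub>o m) \<circ> assoc) ((a \<otimes> b) \<otimes> c)"
    using quantum_set by (simp add: quantum_set_def)
  then show ?thesis by (simp add: tmap_otimes assoc_otimes mult_def)
qed

lemma unit_left [simp]: "unit \<cdot> a = a"
proof -
  have "(m \<circ> (u \<otimes>\<^sub>o id)) (1 \<otimes> a) = lunit (1 \<otimes> a)"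
    using quantum_set by (simp add: quantum_set_def)
  then show ?thesis by (simp add: tmap_otimes lunit_otimes mult_def unit_def scaleC_one)
qed

lemma unit_right [simp]: "a \<cdot> unit = a"
proof -
  have "(m \<circ> (id \<otimes>\<^sub>o u)) (a \<otimes> 1) = runit (a \<otimes> 1)"
    using quantum_set by (simp add: quantum_set_def)
  then show ?thesis by (simp add: tmap_otimes runit_otimes mult_def unit_def scaleC_one)
qed

lemma counit_commute: "counit (a \<cdot> b) = counit (b \<cdot> a)"
proof -
  have "(adj u \<circ> m \<circ> swap) (b \<otimes> a) = (adj u \<circ> m) (b \<otimes> a)"
    using quantum_set by (simp add: quantum_set_def)
  then show ?thesis by (simp add: swap_otimes mult_def counit_def)
qed

lemma counit_eq_cinner: "counit a = cinner unit a"
proof -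
  have "cnj (counit a) = cinner a unit"
    using adj_cinner_left[OF clinear_u, of a 1] by (simp add: counit_def unit_def)
  then show ?thesis by (metis cinner_commute complex_cnj_cnj)
qed

lemma cap_otimes [simp]: "cap m u (a \<otimes> b) = counit (a \<cdot> b)"
  by (simp add: cap_def counit_def mult_def)

lemma cap2_otimes [simp]:
  "cap2 m u ((a \<otimes> b) \<otimes> (c \<otimes> d)) = counit (a \<cdot> d) * counit (b \<cdot> c)"
  by (simp add: Defs.cap2_otimes counit_def mult_def)

section \<open>The Casimir element and its dual bases\<close>

lemma cinner_star_left: "cinner (star a) b = counit (a \<cdot> b)"
  by (simp add: star_def adj_cinner_left counit_eq_cinner)

lemma cinner_star_right: "cinner b (star a) = cnj (counit (a \<cdot> b))"
  by (metis cinner_commute cinner_star_left)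

text \<open>Paired with \<open>x \<otimes> y\<close>, the left side gives
  \<open>counit (x \<cdot> y)\<close> and the right side \<open>counit (y \<cdot> x)\<close>; these
  agree because the counit is a trace.\<close>

lemma comult_unit: "adj m unit = (\<Sum>e\<in>onb. star e \<otimes> e)"
proof (rule cinner_ext_left)
  fix z
  have "cinner (adj m unit) = cinner (\<Sum>e\<in>onb. star e \<otimes> e)"
  proof (intro tensor_ext clinear_cinner_right)
    fix x y
    have "cinner (\<Sum>e\<in>onb. star e \<otimes> e) (x \<otimes> y) = counit ((\<Sum>e\<in>onb. cinner e y *\<^sub>C e) \<cdot> x)"
      by (simp add: cinner_sum_left cinner_otimes cinner_star_left mult_sum_left mult_linear
          counit_sum counit_linear mult.commute)
    then show "cinner (adj m unit) (x \<otimes> y) = cinner (\<Sum>e\<in>onb. star e \<otimes> e) (x \<otimes> y)"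
      by (simp add: adj_cinner_left onb_expand flip: counit_eq_cinner)
        (metis counit_commute mult_def)
  qed
  then show "cinner (adj m unit) z = cinner (\<Sum>e\<in>onb. star e \<otimes> e) z"
    by simp
qed

text \<open>The first Frobenius law, evaluated at \<open>b \<otimes> unit\<close>.\<close>

lemma comult_left: "adj m b = (\<Sum>e\<in>onb. (b \<cdot> star e) \<otimes> e)"
proof -
  have "((m \<otimes>\<^sub>o id) \<circ> assoc_inv \<circ> (id \<otimes>\<^sub>o adj m)) (b \<otimes> unit) = (adj m \<circ> m) (b \<otimes> unit)"
    using quantum_set by (simp add: quantum_set_def)
  then show ?thesis
    by (simp add: tmap_otimes clinear_adj comult_unit otimes_sum_right clinear_sum
        assoc_inv_otimes flip: mult_def)
qed

text \<open>The second Frobenius law, evaluated at \<open>unit \<otimes> b\<close>.\<close>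

lemma comult_right: "adj m b = (\<Sum>e\<in>onb. star e \<otimes> (e \<cdot> b))"
proof -
  have "((id \<otimes>\<^sub>o m) \<circ> assoc \<circ> (adj m \<otimes>\<^sub>o id)) (unit \<otimes> b) = (adj m \<circ> m) (unit \<otimes> b)"
    using quantum_set by (simp add: quantum_set_def)
  then show ?thesis
    by (simp add: tmap_otimes clinear_adj comult_unit otimes_sum_left clinear_sum
        assoc_otimes flip: mult_def)
qed

text \<open>Both sides are the image of \<open>adj m b\<close> under the linear map induced by
  \<open>h\<close>.\<close>

lemma casimir_move:
  assumes "cbilinear h"
  shows "(\<Sum>e\<in>onb. h (b \<cdot> star e) e) = (\<Sum>e\<in>onb. h (star e) (e \<cdot> b))"
proof -
  have "tlift h (adj m b) = (\<Sum>e\<in>onb. h (b \<cdot> star e) e)"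
    by (simp add: comult_left clinear_sum clinear_tlift tlift_otimes assms)
  moreover have "tlift h (adj m b) = (\<Sum>e\<in>onb. h (star e) (e \<cdot> b))"
    by (simp add: comult_right clinear_sum clinear_tlift tlift_otimes assms)
  ultimately show ?thesis by simp
qed

text \<open>A counit law, obtained as the adjoint of \<open>unit \<cdot> y = y\<close>. With
  \<open>casimir_left\<close> it says that the vectors \<open>star e\<close> and \<open>e\<close>
  form dual bases for the trace form \<open>counit (a \<cdot> b)\<close>.\<close>

lemma casimir_right: "(\<Sum>e\<in>onb. counit (a \<cdot> star e) *\<^sub>C e) = a"
proof (rule cinner_ext_right)
  fix y
  have "cinner (unit \<otimes> y) (adj m a) = cinner y a"
    by (metis adj_cinner_left cinner_commute clinear_m mult_def unit_left)
  then show "cinner y (\<Sum>e\<in>onb. counit (a \<cdot> star e) *\<^sub>C e) = cinner y a"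
    by (simp add: comult_left cinner_sum_right cinner_otimes cinner_scaleC_right
        counit_eq_cinner)
qed

lemma casimir_left: "(\<Sum>e\<in>onb. counit (e \<cdot> a) *\<^sub>C star e) = a"
proof (rule cinner_ext_right)
  fix y
  have "cinner (y \<otimes> unit) (adj m a) = cinner y a"
    by (metis adj_cinner_left cinner_commute clinear_m mult_def unit_right)
  then show "cinner y (\<Sum>e\<in>onb. counit (e \<cdot> a) *\<^sub>C star e) = cinner y a"
    by (simp add: comult_right cinner_sum_right cinner_otimes cinner_scaleC_right
        counit_eq_cinner mult.commute)
qed

section \<open>The involution and adjoints of multiplications\<close>

lemma star_unique:
  assumes "\<And>b. cinner x b = counit (a \<cdot> b)" shows "star a = x"
  by (rule cinner_ext_left) (simp add: assms cinner_star_left)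

text \<open>Moving \<open>m\<close> to the other side as \<open>adj m\<close> and expanding it by
  \<open>comult_right\<close> leaves the coefficients \<open>cinner a (star e)\<close>. By the trace
  property these are the coordinates of \<open>star a\<close>.\<close>

lemma cinner_mult_left: "cinner (a \<cdot> x) y = cinner x (star a \<cdot> y)"
proof -
  have *: "cinner a (star e) = cinner e (star a)" for e
    by (simp add: cinner_star_right counit_commute)
  have "cinner (a \<cdot> x) y = cinner (a \<otimes> x) (adj m y)"
    by (metis adj_cinner_left cinner_commute clinear_m mult_def)
  also have "\<dots> = cinner x ((\<Sum>e\<in>onb. cinner e (star a) *\<^sub>C e) \<cdot> y)"
    by (simp add: comult_right cinner_sum_right cinner_otimes cinner_scaleC_right
        mult_sum_left mult_linear *)
  finally show ?thesis by (simp add: onb_expand)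
qed

lemma star_star [simp]: "star (star a) = a"
  by (rule cinner_ext_left)
    (metis cinner_star_left counit_eq_cinner cinner_mult_left unit_right)

lemma star_mult: "star (a \<cdot> b) = star b \<cdot> star a"
  by (rule star_unique)
    (metis cinner_mult_left cinner_star_left mult_assoc star_star)

lemma cinner_eq_counit: "cinner a b = counit (star a \<cdot> b)"
  by (metis cinner_star_left star_star)

lemma cinner_mult_right: "cinner (x \<cdot> a) y = cinner x (y \<cdot> star a)"
  by (metis cinner_eq_counit counit_commute mult_assoc star_mult)

section \<open>Relations of graphs\<close>

lemma relation_of_graph_otimes:
  assumes "clinear G"
  shows "relation_of_graph m G (a \<otimes> b) = (\<Sum>e\<in>onb. (a \<cdot> G (star e)) \<otimes> (e \<cdot> b))"
  by (simp add: relation_of_graph_def tmap_otimes clinear_adj comult_right otimes_sum_right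
      clinear_sum assms assoc_inv_otimes mult_def)

text \<open>Contracting the second leg of the value at \<open>unit \<otimes> unit\<close> with
  \<open>counit (x \<cdot> a)\<close> collapses the Casimir sum inside the map and returns its value
  at \<open>a\<close>.\<close>

lemma relation_of_graph_inject:
  assumes F: "clinear F" and G: "clinear G"
    and eq: "relation_of_graph m F (unit \<otimes> unit) = relation_of_graph m G (unit \<otimes> unit)"
  shows "F = G"
proof
  fix a
  have "runit ((id \<otimes>\<^sub>o (\<lambda>x. counit (x \<cdot> a))) (relation_of_graph m H (unit \<otimes> unit))) = H a"
    if H: "clinear H" for H
  proof -
    have "clinear (\<lambda>x. counit (x \<cdot> a))"
      by (rule clinear_compose[OF clinear_mult(2) clinear_counit])
    then have "runit ((id \<otimes>\<^sub>o (\<lambda>x. counit (x \<cdot> a))) (relation_of_graph m H (unit \<otimes> unit)))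
        = H (\<Sum>e\<in>onb. counit (e \<cdot> a) *\<^sub>C star e)"
      by (simp add: relation_of_graph_otimes H clinear_sum tmap_otimes runit_otimes clinear_scale)
    then show ?thesis by (simp add: casimir_left)
  qed
  then show "F a = G a" using F G eq by metis
qed

text \<open>For the algebra of functions on a finite set this is the entrywise product of
  matrices.\<close>

definition schur :: "('a \<Rightarrow> 'a) \<Rightarrow> ('a \<Rightarrow> 'a) \<Rightarrow> 'a \<Rightarrow> 'a"
  where "schur F G = m \<circ> (F \<otimes>\<^sub>o G) \<circ> adj m"

lemma clinear_schur: "clinear (schur F G)"
  by (auto simp: schur_def intro!: clinear_comp clinear_adj)

lemma schur_apply:
  assumes "clinear F" "clinear G"
  shows "schur F G a = (\<Sum>e\<in>onb. F (star e) \<cdot> G (e \<cdot> a))"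
  by (simp add: schur_def comult_right clinear_sum tmap_otimes assms mult_def)

lemma schur_apply':
  assumes "clinear F" "clinear G"
  shows "schur F G a = (\<Sum>e\<in>onb. F (a \<cdot> star e) \<cdot> G e)"
  by (simp add: schur_def comult_left clinear_sum tmap_otimes assms mult_def)

text \<open>The double Casimir sum that arises when two relations are composed. Moving
  \<open>e\<close> across the inner Casimir element places it inside \<open>G\<close>, where the sum
  over \<open>e\<close> becomes a Schur product.\<close>

lemma casimir_schur:
  assumes F: "clinear F" and G: "clinear G" and h: "cbilinear h"
  shows "(\<Sum>e\<in>onb. \<Sum>e'\<in>onb. h (F (star e) \<cdot> G (star e')) (e' \<cdot> e))
    = (\<Sum>e\<in>onb. h (schur F G (star e)) e)"
proof -
  have l: "clinear (\<lambda>a. h a b)" for b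
    using h by (auto simp: cbilinear_def)
  have "(\<Sum>e\<in>onb. \<Sum>e'\<in>onb. h (F (star e) \<cdot> G (star e')) (e' \<cdot> e))
      = (\<Sum>e\<in>onb. \<Sum>e'\<in>onb. h (F (star e) \<cdot> G (e \<cdot> star e')) e')"
  proof (rule sum.cong[OF refl])
    fix e :: 'a
    have "cbilinear (\<lambda>a b. h (F (star e) \<cdot> G a) b)"
      using h G unfolding cbilinear_def by (auto simp: clinear_iff mult_linear)
    from casimir_move[OF this]
    show "(\<Sum>e'\<in>onb. h (F (star e) \<cdot> G (star e')) (e' \<cdot> e))
        = (\<Sum>e'\<in>onb. h (F (star e) \<cdot> G (e \<cdot> star e')) e')"
      by (rule sym)
  qed
  also have "\<dots> = (\<Sum>e'\<in>onb. \<Sum>e\<in>onb. h (F (star e) \<cdot> G (e \<cdot> star e')) e')"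
    by (rule sum.swap)
  also have "\<dots> = (\<Sum>e\<in>onb. h (schur F G (star e)) e)"
    by (simp add: schur_apply F G clinear_sum[OF l])
  finally show ?thesis .
qed

text \<open>Each relation inserts its factors on the inner sides of the two legs, so the map applied
  first contributes the left factor of the Schur product.\<close>

lemma relation_of_graph_comp:
  assumes F: "clinear F" and G: "clinear G"
  shows "relation_of_graph m G \<circ> relation_of_graph m F = relation_of_graph m (schur F G)"
proof (intro tensor_ext clinear_comp clinear_relation_of_graph)
  fix a b
  have "cbilinear (\<lambda>x y. (a \<cdot> x) \<otimes> (y \<cdot> b))"
    by (auto simp: cbilinear_def clinear_iff mult_linear otimes_linear)
  from casimir_schur[OF F G this]
  show "(relation_of_graph m G \<circ> relation_of_graph m F) (a \<otimes> b)
      = relation_of_graph m (schur F G) (a \<otimes> b)"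
    by (simp add: relation_of_graph_otimes F G clinear_schur clinear_sum clinear_relation_of_graph
        mult_assoc)
qed

lemma relation_of_graph_idem_iff:
  assumes "clinear G"
  shows "relation_of_graph m G \<circ> relation_of_graph m G = relation_of_graph m G
    \<longleftrightarrow> schur G G = G"
  using relation_of_graph_comp[OF assms assms] relation_of_graph_inject[OF clinear_schur assms]
  by metis

text \<open>Factors are inserted only between the two legs, so outer multiplications pass through by
  associativity.\<close>

lemma relation_of_graph_bimodule:
  assumes G: "clinear G"
  shows "relation_of_graph m G \<circ> (m \<otimes>\<^sub>o m)
    = (m \<otimes>\<^sub>o m) \<circ> rebracket_inv \<circ> (id \<otimes>\<^sub>o (relation_of_graph m G \<otimes>\<^sub>o id)) \<circ> rebracket"
    (is "?L = ?R")
proof -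
  have "?L ((a \<otimes> b) \<otimes> (c \<otimes> d)) = ?R ((a \<otimes> b) \<otimes> (c \<otimes> d))" for a b c d
    by (simp add: tmap_otimes relation_of_graph_otimes G rebracket_def rebracket_inv_def
        assoc_otimes assoc_inv_otimes clinear_relation_of_graph otimes_sum_left otimes_sum_right
        clinear_sum mult_assoc flip: mult_def)
  moreover have "clinear ?L" "clinear ?R"
    by (auto simp: rebracket_def rebracket_inv_def intro!: clinear_comp clinear_relation_of_graph)
  ultimately have "(\<lambda>x y. ?L (x \<otimes> y)) = (\<lambda>x y. ?R (x \<otimes> y))"
    by (intro cbilinear_tensor_ext)
      (simp_all only: cbilinear_def clinear_iff otimes_linear simp_thms)
  then show ?thesis
    using \<open>clinear ?L\<close> \<open>clinear ?R\<close> by (intro tensor_ext) meson+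
qed

section \<open>Symmetry\<close>

lemma rotation_cup_iff:
  assumes "clinear G"
  shows "rotation (cup m u) (cap m u) G = G \<longleftrightarrow> (\<forall>a b. counit (G a \<cdot> b) = counit (a \<cdot> G b))"
proof -
  \<comment> \<open>The two zigzag identities for this cup are \<open>casimir_right\<close> and
    \<open>casimir_left\<close>.\<close>
  have "cup m u 1 = (\<Sum>e\<in>onb. star e \<otimes> e)"
    by (simp add: cup_def comult_unit flip: unit_def)
  then show ?thesis
    using assms
    by (subst rotation_eq_self_iff)
      (auto simp: clinear_cup clinear_cap casimir_left casimir_right)
qed

text \<open>On elementary tensors the nested cap splits the double sum into two independent Casimir
  sums. Nesting reverses the order of the legs, hence \<open>e' \<otimes> e\<close> against
  \<open>star e \<otimes> star e'\<close>.\<close>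

lemma cap2_zigzag_left:
  "(\<Sum>e\<in>onb. \<Sum>e'\<in>onb. cap2 m u (z \<otimes> (star e \<otimes> star e')) *\<^sub>C (e' \<otimes> e)) = z"
    (is "?f z = z")
proof -
  have "?f = id"
  proof (intro tensor_ext)
    show "clinear ?f"
      using clinear_cap2[OF clinear_m clinear_u]
      by (simp add: clinear_iff otimes_linear scaleC_add_left sum.distrib cvec.scale_sum_right)
    fix a b
    have "?f (a \<otimes> b) = (\<Sum>e'\<in>onb. counit (a \<cdot> star e') *\<^sub>C e') \<otimes>
        (\<Sum>e\<in>onb. counit (b \<cdot> star e) *\<^sub>C e)"
      by (simp add: otimes_sum_left otimes_sum_right otimes_linear cvec.scale_sum_right mult.commute)
    then show "?f (a \<otimes> b) = id (a \<otimes> b)"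
      by (simp add: casimir_right)
  qed simp
  then have "?f z = id z" by (rule fun_cong)
  then show ?thesis by (simp only: id_apply)
qed

lemma cap2_zigzag_right:
  "(\<Sum>e\<in>onb. \<Sum>e'\<in>onb. cap2 m u ((e' \<otimes> e) \<otimes> z) *\<^sub>C (star e \<otimes> star e')) = z"
    (is "?f z = z")
proof -
  have "?f = id"
  proof (intro tensor_ext)
    show "clinear ?f"
      using clinear_cap2[OF clinear_m clinear_u]
      by (simp add: clinear_iff otimes_linear scaleC_add_left sum.distrib cvec.scale_sum_right)
    fix c d
    have "?f (c \<otimes> d) = (\<Sum>e\<in>onb. counit (e \<cdot> c) *\<^sub>C star e) \<otimes>
        (\<Sum>e'\<in>onb. counit (e' \<cdot> d) *\<^sub>C star e')"
      by (subst sum.swap)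
        (simp add: otimes_sum_left otimes_sum_right otimes_linear cvec.scale_sum_right mult.commute)
    then show "?f (c \<otimes> d) = id (c \<otimes> d)"
      by (simp add: casimir_left)
  qed simp
  then have "?f z = id z" by (rule fun_cong)
  then show ?thesis by (simp only: id_apply)
qed

lemma cap2_nondegenerate:
  assumes "\<And>c d. cap2 m u (S \<otimes> (c \<otimes> d)) = cap2 m u (T \<otimes> (c \<otimes> d))"
  shows "S = T"
  by (subst (1 2) cap2_zigzag_left[symmetric]) (simp only: assms)

lemma symmetric_relation_iff:
  assumes P: "clinear P"
  shows "symmetric_relation m u P \<longleftrightarrow>
    (\<forall>a b c d. cap2 m u (P (a \<otimes> b) \<otimes> (c \<otimes> d)) = cap2 m u ((a \<otimes> b) \<otimes> P (c \<otimes> d)))"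
proof -
  \<comment> \<open>The legs of the nested cup: inserting one Casimir element into the middle of
    another gives \<open>(star e \<otimes> star e') \<otimes> (e' \<otimes> e)\<close>.\<close>
  define x y where "x = (\<lambda>(e, e'). star e \<otimes> star e')"
    and "y = (\<lambda>(e, e'). (e' :: 'a) \<otimes> (e :: 'a))"
  have "cup m u 1 = (\<Sum>e\<in>onb. star e \<otimes> e)"
    by (simp add: cup_def comult_unit flip: unit_def)
  then have n: "cup2 m u 1 = (\<Sum>i\<in>onb \<times> onb. x i \<otimes> y i)"
    by (simp add: cup2_def clinear_sum tmap_otimes lunit_inv_def clinear_cup
        otimes_sum_left otimes_sum_right rebracket_inv_def assoc_otimes assoc_inv_otimes
        x_def y_def sum.cartesian_product split_def)
  have zigzag: "(\<Sum>i\<in>onb \<times> onb. cap2 m u (z \<otimes> x i) *\<^sub>C y i) = z"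
    "(\<Sum>i\<in>onb \<times> onb. cap2 m u (y i \<otimes> z) *\<^sub>C x i) = z" for z
    using cap2_zigzag_left[of z] cap2_zigzag_right[of z]
    by (simp_all add: x_def y_def sum.cartesian_product split_def)
  have "symmetric_relation m u P \<longleftrightarrow>
      (\<forall>z h. cap2 m u (P z \<otimes> h) = cap2 m u (z \<otimes> P h))"
    unfolding symmetric_relation_def
    by (rule rotation_eq_self_iff[where x = x and y = y and I = "onb \<times> onb"])
      (simp_all add: clinear_cup2 clinear_cap2 n P zigzag)
  also have "\<dots> \<longleftrightarrow>
    (\<forall>a b c d. cap2 m u (P (a \<otimes> b) \<otimes> (c \<otimes> d)) = cap2 m u ((a \<otimes> b) \<otimes> P (c \<otimes> d)))"
  proof
    assume *: "\<forall>a b c d. cap2 m u (P (a \<otimes> b) \<otimes> (c \<otimes> d)) = cap2 m u ((a \<otimes> b) \<otimes> P (c \<otimes> d))"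
    have "(\<lambda>z h. cap2 m u (P z \<otimes> h)) = (\<lambda>z h. cap2 m u (z \<otimes> P h))"
      using P clinear_cap2[OF clinear_m clinear_u] *
      by (intro cbilinear_tensor_ext) (simp_all add: cbilinear_def clinear_iff otimes_linear)
    then show "\<forall>z h. cap2 m u (P z \<otimes> h) = cap2 m u (z \<otimes> P h)"
      by (simp add: fun_eq_iff)
  qed blast
  finally show ?thesis .
qed

text \<open>The inner cap yields the scalar \<open>counit (e \<cdot> (b \<cdot> c))\<close>, so
  \<open>casimir_left\<close> contracts the sum inside \<open>G\<close>.\<close>

lemma cap2_relation_of_graph_left:
  assumes G: "clinear G"
  shows "cap2 m u (relation_of_graph m G (a \<otimes> b) \<otimes> (c \<otimes> d)) = counit (a \<cdot> G (b \<cdot> c) \<cdot> d)"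
proof -
  have "counit (a \<cdot> G (\<Sum>e\<in>onb. counit (e \<cdot> (b \<cdot> c)) *\<^sub>C star e) \<cdot> d)
      = (\<Sum>e\<in>onb. counit (a \<cdot> G (star e) \<cdot> d) * counit (e \<cdot> (b \<cdot> c)))"
    by (simp add: clinear_sum[OF G] clinear_scale[OF G] mult_sum_left mult_sum_right mult_linear
        counit_sum counit_linear mult.commute)
  then show ?thesis
    by (simp add: relation_of_graph_otimes G otimes_sum_left clinear_sum clinear_cap2 casimir_left
        mult_assoc)
qed

lemma cap2_relation_of_graph_right:
  assumes G: "clinear G"
  shows "cap2 m u ((a \<otimes> b) \<otimes> relation_of_graph m G (c \<otimes> d)) = counit (b \<cdot> c \<cdot> G (d \<cdot> a))"
proof -
  have "counit (b \<cdot> c \<cdot> G (\<Sum>e\<in>onb. counit (e \<cdot> (d \<cdot> a)) *\<^sub>C star e))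
      = (\<Sum>e\<in>onb. counit (e \<cdot> d \<cdot> a) * counit (b \<cdot> (c \<cdot> G (star e))))"
    by (simp add: clinear_sum[OF G] clinear_scale[OF G] mult_sum_left mult_sum_right mult_linear
        counit_sum counit_linear mult_assoc)
  then show ?thesis
    by (simp add: relation_of_graph_otimes G otimes_sum_right clinear_sum clinear_cap2 casimir_left
        counit_commute[of a])
qed

text \<open>The rotation axiom in elementwise form: \<open>G\<close> equals its transpose for the
  bilinear trace form. Self-adjointness refers to the sesquilinear inner product instead.\<close>

definition symmetric :: "('a \<Rightarrow> 'a) \<Rightarrow> bool"
  where "symmetric G \<longleftrightarrow> (\<forall>a b. counit (G a \<cdot> b) = counit (a \<cdot> G b))"

lemma symmetric_relation_of_graph_iff:
  assumes G: "clinear G"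
  shows "symmetric_relation m u (relation_of_graph m G) \<longleftrightarrow> symmetric G"
  unfolding symmetric_relation_iff[OF clinear_relation_of_graph]
    cap2_relation_of_graph_left[OF G] cap2_relation_of_graph_right[OF G]
proof
  assume *: "\<forall>a b c d. counit (a \<cdot> G (b \<cdot> c) \<cdot> d) = counit (b \<cdot> c \<cdot> G (d \<cdot> a))"
  have "counit (G a \<cdot> b) = counit (a \<cdot> G b)" for a b
    using *[rule_format, of unit unit a b] by simp
  then show "symmetric G" by (simp add: symmetric_def)
qed (metis symmetric_def counit_commute mult_assoc)

lemma graph_of_relation_of_graph:
  assumes G: "clinear G" and sym: "symmetric G"
  shows "graph_of_relation u (relation_of_graph m G) = G"
proof
  fix a
  have "graph_of_relation u (relation_of_graph m G) a
      = (\<Sum>e\<in>onb. counit (a \<cdot> G (star e)) *\<^sub>C e)"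
    by (simp add: graph_of_relation_def runit_inv_def tmap_otimes clinear_adj
        relation_of_graph_otimes G clinear_sum lunit_otimes flip: unit_def counit_def)
  \<comment> \<open>Without symmetry the construction would read off the transpose of
    \<open>G\<close>; symmetry moves \<open>G\<close> onto \<open>a\<close>.\<close>
  also have "\<dots> = (\<Sum>e\<in>onb. counit (G a \<cdot> star e) *\<^sub>C e)"
    using sym by (simp add: symmetric_def)
  finally show "graph_of_relation u (relation_of_graph m G) a = G a"
    by (simp add: casimir_right)
qed

lemma relation_of_graph_of_relation:
  assumes P: "quantum_relation m u P" and sym: "symmetric_relation m u P"
  shows "relation_of_graph m (graph_of_relation u P) = P"
proof -
  let ?G = "graph_of_relation u P"
  have lin: "clinear P"
    using P by (simp add: quantum_relation_def projector_def)
  have G: "clinear ?G" by (simp add: clinear_graph_of_relation lin)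
  \<comment> \<open>The outer bimodule action, \<open>x \<otimes> y\<close> to
    \<open>(a \<cdot> x) \<otimes> (y \<cdot> d)\<close>, defined on all tensors because values of
    \<open>P\<close> need not be elementary.\<close>
  define act where "act a d = (m \<otimes>\<^sub>o m) \<circ> rebracket_inv \<circ> (\<lambda>t. a \<otimes> (t \<otimes> d))" for a d
  have clin_act: "clinear (act a d)" for a d
    unfolding act_def rebracket_inv_def
    by (intro clinear_comp clinear_structural) (auto simp: clinear_iff otimes_linear)
  have act: "act a d (x \<otimes> y) = (a \<cdot> x) \<otimes> (y \<cdot> d)" for a d x y
    by (simp add: act_def rebracket_inv_def tmap_otimes assoc_otimes assoc_inv_otimes mult_def)
  have bimod: "Q ((a \<cdot> b) \<otimes> (c \<cdot> d)) = act a d (Q (b \<otimes> c))"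
    if "clinear Q" and
      Q: "Q \<circ> (m \<otimes>\<^sub>o m) = (m \<otimes>\<^sub>o m) \<circ> rebracket_inv \<circ> (id \<otimes>\<^sub>o (Q \<otimes>\<^sub>o id)) \<circ> rebracket"
    for Q a b c d
    using fun_cong[OF Q, of "(a \<otimes> b) \<otimes> (c \<otimes> d)"] that(1)
    by (simp add: tmap_otimes rebracket_def assoc_otimes assoc_inv_otimes act_def flip: mult_def)
  have bP: "P ((a \<cdot> b) \<otimes> (c \<cdot> d)) = act a d (P (b \<otimes> c))" for a b c d
    using P lin by (intro bimod) (auto simp: quantum_relation_def)
  have bG: "relation_of_graph m ?G ((a \<cdot> b) \<otimes> (c \<cdot> d))
      = act a d (relation_of_graph m ?G (b \<otimes> c))" for a b c d
    by (intro bimod relation_of_graph_bimodule clinear_relation_of_graph G)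
  \<comment> \<open>Pairing with \<open>unit \<otimes> unit\<close> applies the counit to both legs,
    while \<open>d\<close> stays on the second.\<close>
  have *: "cap2 m u ((unit \<otimes> unit) \<otimes> act unit d T) = counit (lunit ((counit \<otimes>\<^sub>o id) T) \<cdot> d)" for d T
  proof -
    have "(\<lambda>T. cap2 m u ((unit \<otimes> unit) \<otimes> act unit d T))
        = (\<lambda>T. counit (lunit ((counit \<otimes>\<^sub>o id) T) \<cdot> d))"
    proof (intro tensor_ext)
      show "clinear (\<lambda>T. cap2 m u ((unit \<otimes> unit) \<otimes> act unit d T))"
        using clin_act[of unit d] clinear_cap2[OF clinear_m clinear_u]
        by (simp add: clinear_iff otimes_linear)
      have "clinear (\<lambda>T::'a \<otimes> 'a. lunit ((counit \<otimes>\<^sub>o id) T) :: 'a)"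
        by (rule clinear_compose[OF clinear_structural(2) clinear_structural(6)])
      then show "clinear (\<lambda>T. counit (lunit ((counit \<otimes>\<^sub>o id) T) \<cdot> d))"
        by (simp add: clinear_iff mult_linear counit_linear)
    qed (simp add: act tmap_otimes lunit_otimes mult_linear counit_linear mult.commute)
    then show ?thesis by meson
  qed
  have "cap2 m u (P (unit \<otimes> unit) \<otimes> (c \<otimes> d))
      = cap2 m u (relation_of_graph m ?G (unit \<otimes> unit) \<otimes> (c \<otimes> d))" for c d
  proof -
    have "cap2 m u (P (unit \<otimes> unit) \<otimes> (c \<otimes> d)) = cap2 m u ((unit \<otimes> unit) \<otimes> P (c \<otimes> d))"
      using sym by (simp add: symmetric_relation_iff lin)
    \<comment> \<open>Splitting off \<open>d\<close> exposes \<open>P (c \<otimes> unit)\<close>,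
      from which \<open>?G c\<close> is read.\<close>
    also have "P (c \<otimes> d) = act unit d (P (c \<otimes> unit))"
      using bP[of unit c unit d] by simp
    also have "cap2 m u ((unit \<otimes> unit) \<otimes> \<dots>) = counit (?G c \<cdot> d)"
      by (simp add: * graph_of_relation_def runit_inv_def tmap_otimes flip: unit_def counit_def)
    finally show ?thesis
      by (simp add: cap2_relation_of_graph_left G)
  qed
  then have "P (unit \<otimes> unit) = relation_of_graph m ?G (unit \<otimes> unit)"
    by (rule cap2_nondegenerate)
  \<comment> \<open>Both maps arise from their value at \<open>unit \<otimes> unit\<close> through
    \<open>act a d\<close>.\<close>
  then have "relation_of_graph m ?G (a \<otimes> d) = P (a \<otimes> d)" for a d
    using bP[of a unit unit d] bG[of a unit unit d] by simp
  then show ?thesis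
    by (intro tensor_ext lin clinear_relation_of_graph)
qed

section \<open>The correspondence\<close>

text \<open>For symmetric \<open>G\<close>, either side amounts to \<open>G\<close> commuting with
  \<open>star\<close>. The matrix coefficients \<open>left\<close> and \<open>right\<close> come
  from contracting the Casimir sum.\<close>

lemma adj_relation_of_graph_iff:
  assumes G: "clinear G" and sym: "symmetric G"
  shows "adj (relation_of_graph m G) = relation_of_graph m G \<longleftrightarrow> adj G = G"
proof -
  have left: "cinner (relation_of_graph m G (a \<otimes> b)) (c \<otimes> d)
      = cinner (a \<cdot> G (b \<cdot> star d)) c" for a b c d
  proof -
    have "counit (e \<cdot> (b \<cdot> star d)) = cinner d (e \<cdot> b)" for e
      by (metis cinner_eq_counit counit_commute mult_assoc)
    then have "a \<cdot> G (\<Sum>e\<in>onb. counit (e \<cdot> (b \<cdot> star d)) *\<^sub>C star e)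
        = (\<Sum>e\<in>onb. cinner d (e \<cdot> b) *\<^sub>C (a \<cdot> G (star e)))"
      by (simp only: clinear_sum[OF G] clinear_scale[OF G] mult_sum_right mult_linear)
    then have "a \<cdot> G (b \<cdot> star d) = (\<Sum>e\<in>onb. cinner d (e \<cdot> b) *\<^sub>C (a \<cdot> G (star e)))"
      by (simp only: casimir_left)
    then show ?thesis
      by (simp add: relation_of_graph_otimes G cinner_sum_left cinner_otimes cinner_scaleC_left
          cinner_commute[symmetric] mult.commute)
  qed
  have right: "cinner (a \<otimes> b) (relation_of_graph m G (c \<otimes> d))
      = cinner a (c \<cdot> G (d \<cdot> star b))" for a b c d
  proof -
    have "counit (e \<cdot> (d \<cdot> star b)) = cinner b (e \<cdot> d)" for e
      by (metis cinner_eq_counit counit_commute mult_assoc)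
    then have "c \<cdot> G (\<Sum>e\<in>onb. counit (e \<cdot> (d \<cdot> star b)) *\<^sub>C star e)
        = (\<Sum>e\<in>onb. cinner b (e \<cdot> d) *\<^sub>C (c \<cdot> G (star e)))"
      by (simp only: clinear_sum[OF G] clinear_scale[OF G] mult_sum_right mult_linear)
    then have "c \<cdot> G (d \<cdot> star b) = (\<Sum>e\<in>onb. cinner b (e \<cdot> d) *\<^sub>C (c \<cdot> G (star e)))"
      by (simp only: casimir_left)
    then show ?thesis
      by (simp add: relation_of_graph_otimes G cinner_sum_right cinner_otimes cinner_scaleC_right
          mult.commute)
  qed
  show ?thesis
    unfolding adj_tensor_eq_self_iff[OF clinear_relation_of_graph] left right adj_eq_self_iff[OF G]
  proof
    assume *: "\<forall>a b c d. cinner (a \<cdot> G (b \<cdot> star d)) c = cinner a (c \<cdot> G (d \<cdot> star b))"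
    have star_unit: "star unit = unit"
      by (rule star_unique) (simp add: counit_eq_cinner)
    \<comment> \<open>The case \<open>a = b = unit\<close>, \<open>d = star x\<close>,
      \<open>c = y\<close>.\<close>
    have "cinner (G x) y = counit (y \<cdot> G (star x))" for x y
      using *[rule_format, of unit unit "star x" y] by (simp add: star_unit flip: counit_eq_cinner)
    then show "\<forall>x y. cinner (G x) y = cinner x (G y)"
      using sym by (metis cinner_eq_counit counit_commute symmetric_def)
  next
    assume *: "\<forall>x y. cinner (G x) y = cinner x (G y)"
    have "star (G x) = G (star x)" for x
      by (rule star_unique) (use * sym in \<open>simp add: cinner_star_left symmetric_def\<close>)
    then show "\<forall>a b c d. cinner (a \<cdot> G (b \<cdot> star d)) c = cinner a (c \<cdot> G (d \<cdot> star b))"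
      by (simp add: cinner_mult_right star_mult)
  qed
qed

text \<open>Expanding \<open>G (star e)\<close> in the dual basis and exchanging the sums turns the
  coefficients into those of \<open>G e'\<close>, so \<open>G\<close> passes to the other leg of the
  Casimir element.\<close>

lemma casimir_symmetric:
  assumes G: "clinear G" and sym: "symmetric G" and h: "cbilinear h"
  shows "(\<Sum>e\<in>onb. h (G (star e)) e) = (\<Sum>e\<in>onb. h (star e) (G e))"
proof -
  have l: "clinear (\<lambda>a. h a b)" and r: "clinear (h a)" for a b
    using h by (auto simp: cbilinear_def)
  have "(\<Sum>e\<in>onb. h (G (star e)) e)
      = (\<Sum>e\<in>onb. h (\<Sum>e'\<in>onb. counit (e' \<cdot> G (star e)) *\<^sub>C star e') e)"
    by (simp add: casimir_left)
  also have "\<dots> = (\<Sum>e'\<in>onb. h (star e') (\<Sum>e\<in>onb. counit (e' \<cdot> G (star e)) *\<^sub>C e))"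
    by (simp add: clinear_sum[OF l] clinear_sum[OF r] clinear_scale[OF l] clinear_scale[OF r])
      (rule sum.swap)
  also have "\<dots> = (\<Sum>e'\<in>onb. h (star e') (\<Sum>e\<in>onb. counit (G e' \<cdot> star e) *\<^sub>C e))"
    using sym by (simp add: symmetric_def)
  also have "\<dots> = (\<Sum>e\<in>onb. h (star e) (G e))"
    by (simp add: casimir_right)
  finally show ?thesis .
qed

text \<open>Reflexivity of a graph has \<open>id\<close> on the right, that of its relation has it
  on the left. Both products are multiplication by the same element
  \<open>(\<Sum>e\<in>onb. star e \<cdot> G e)\<close>, from opposite sides, so each condition says
  that this element is \<open>unit\<close>.\<close>

lemma schur_id_left_iff:
  assumes G: "clinear G" and sym: "symmetric G"
  shows "schur id G = id \<longleftrightarrow> schur G id = id"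
proof -
  have "cbilinear (\<cdot>)" by (simp add: cbilinear_def)
  then have *: "(\<Sum>e\<in>onb. G (star e) \<cdot> e) = (\<Sum>e\<in>onb. star e \<cdot> G e)"
    by (rule casimir_symmetric[OF G sym])
  have "schur id G a = a \<cdot> (\<Sum>e\<in>onb. star e \<cdot> G e)" for a
    by (simp add: schur_apply' G mult_sum_right mult_assoc)
  moreover have "schur G id a = (\<Sum>e\<in>onb. star e \<cdot> G e) \<cdot> a" for a
    by (simp add: schur_apply G mult_assoc mult_sum_left flip: *)
  ultimately show ?thesis
    by (metis (no_types, lifting) ext id_apply unit_left unit_right)
qed

lemma reflexive_relation_of_graph_iff:
  assumes G: "clinear G"
  shows "reflexive_relation m u (relation_of_graph m G) \<longleftrightarrow> schur id G = id"
proof -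
  let ?P = "relation_of_graph m"
  have u: "u z = z *\<^sub>C unit" for z
    using clinear_scale[OF clinear_u, of z 1] by (simp add: unit_def)
  \<comment> \<open>The cup is itself a value of the relation of \<open>id\<close>, so applying
    \<open>?P G\<close> to it becomes a composition of relations.\<close>
  have "adj m unit = ?P id (unit \<otimes> unit)"
    by (simp add: relation_of_graph_otimes comult_unit)
  moreover have "?P G (?P id (unit \<otimes> unit)) = ?P (schur id G) (unit \<otimes> unit)"
    using relation_of_graph_comp[of id G] G by (metis clinear_structural(1) comp_apply)
  ultimately have "reflexive_relation m u (?P G) \<longleftrightarrow>
      (\<forall>z. z *\<^sub>C ?P (schur id G) (unit \<otimes> unit) = z *\<^sub>C ?P id (unit \<otimes> unit))"
    by (simp add: reflexive_relation_def fun_eq_iff u clinear_scale clinear_adj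
        clinear_relation_of_graph)
  also have "\<dots> \<longleftrightarrow> ?P (schur id G) (unit \<otimes> unit) = ?P id (unit \<otimes> unit)"
    by (metis scaleC_one)
  also have "\<dots> \<longleftrightarrow> schur id G = id"
    using relation_of_graph_inject[OF clinear_schur clinear_structural(1)] by metis
  finally show ?thesis .
qed

lemma reflexive_quantum_graph_iff:
  assumes G: "clinear G"
  shows "reflexive_quantum_graph m u G \<longleftrightarrow>
    quantum_relation m u (relation_of_graph m G) \<and>
    symmetric_relation m u (relation_of_graph m G) \<and>
    reflexive_relation m u (relation_of_graph m G)"
\<comment> \<open>The equivalences for self-adjointness and reflexivity presuppose symmetry. If it
  fails, both sides are false.\<close>
proof (cases "symmetric G")
  case True
  then have "rotation (cup m u) (cap m u) G = G"
    using rotation_cup_iff[OF G] by (simp add: symmetric_def)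
  then show ?thesis
    using True
    by (simp add: reflexive_quantum_graph_def quantum_graph_def quantum_relation_def
        projector_def quantum_set G clinear_relation_of_graph relation_of_graph_bimodule
        adj_relation_of_graph_iff relation_of_graph_idem_iff symmetric_relation_of_graph_iff
        reflexive_relation_of_graph_iff schur_id_left_iff conj_ac flip: schur_def)
next
  case False
  then have "rotation (cup m u) (cap m u) G \<noteq> G"
    using rotation_cup_iff[OF G] by (simp add: symmetric_def)
  then show ?thesis
    using False by (simp add: reflexive_quantum_graph_def quantum_graph_def
        symmetric_relation_of_graph_iff G)
qed

end

theorem theorem7p7:
  fixes m :: "'a::fd_hilbert \<otimes> 'a \<Rightarrow> 'a" and u :: "complex \<Rightarrow> 'a"
  assumes "quantum_set m u"
  shows "(\<forall>G. reflexive_quantum_graph m u G \<longrightarrow>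
            quantum_relation m u (relation_of_graph m G) \<and>
            symmetric_relation m u (relation_of_graph m G) \<and>
            reflexive_relation m u (relation_of_graph m G)) \<and>
         (\<forall>P. quantum_relation m u P \<and> symmetric_relation m u P \<and> reflexive_relation m u P \<longrightarrow>
            reflexive_quantum_graph m u (graph_of_relation u P)) \<and>
         (\<forall>G. reflexive_quantum_graph m u G \<longrightarrow>
            graph_of_relation u (relation_of_graph m G) = G) \<and>
         (\<forall>P. quantum_relation m u P \<and> symmetric_relation m u P \<and> reflexive_relation m u P \<longrightarrow>
            relation_of_graph m (graph_of_relation u P) = P)"
proof -
  interpret qset m u by unfold_locales (fact assms)
  have lin: "clinear G" if "reflexive_quantum_graph m u G" for G
    using that by (simp add: reflexive_quantum_graph_def quantum_graph_def)
  have lin': "clinear (graph_of_relation u P)" if "quantum_relation m u P" for P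
    using that by (simp add: quantum_relation_def projector_def clinear_graph_of_relation)
  have "graph_of_relation u (relation_of_graph m G) = G" if "reflexive_quantum_graph m u G" for G
    using that lin[OF that] reflexive_quantum_graph_iff symmetric_relation_of_graph_iff
      graph_of_relation_of_graph by blast
  moreover have "reflexive_quantum_graph m u (graph_of_relation u P)"
    if "quantum_relation m u P \<and> symmetric_relation m u P \<and> reflexive_relation m u P" for P
    \<comment> \<open>The equivalence is applied to \<open>graph_of_relation u P\<close>, whose
      relation is \<open>P\<close> again.\<close>
    using that by (simp add: reflexive_quantum_graph_iff lin' relation_of_graph_of_relation)
  ultimately show ?thesis
    using reflexive_quantum_graph_iff[OF lin] relation_of_graph_of_relation by blast
qed

end
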